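(* Let $G$ be a real, connected, compact, semisimple Lie group, and let $\mathcal{X}$ be a linear vector field on $G$ with linear flow $\varphi_t$. Then every fixed point of $\varphi_t$ is stable.
   Context: A vector field $\mathcal{X}$ on a Lie group $G$ is called linear if its flow $(\varphi_t)_{t\in\mathbb{R}}$ is a family of automorphisms of the Lie group $G$; $\varphi_t$ is then called the linear flow of $\mathcal{X}$. A fixed point is a point $g\in G$ with $\varphi_t(g)=g$ for all $t\in\mathbb{R}$. A fixed point $g$ is stable if for every neighborhood $U$ of $g$ there is a neighborhood $V$ of $g$ such that $\varphi_t(V)\subset U$ for all $t\ge 0$. *)

theory Defs
  imports "HOL-Analysis.Analysis" "HOL-Algebra.Group"
begin

section \<open>Smooth manifolds\<close>

text \<open>
  Used for sets \<open>S\<close> that are open, where this is the usual notion of \<open>C\<^sup>k\<close>, and for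
  \<open>S \<subseteq> {0}\<close>, where it holds for every map, as it should on a manifold of dimension zero.
\<close>

primrec C_k_on ::
  "nat \<Rightarrow> ('a::real_normed_vector \<Rightarrow> 'b::real_normed_vector) \<Rightarrow> 'a set \<Rightarrow> bool" where
  "C_k_on 0 f S \<longleftrightarrow> continuous_on S f"
| "C_k_on (Suc k) f S \<longleftrightarrow>
     (\<forall>x\<in>S. f differentiable (at x within S)) \<and>
     (\<forall>v. C_k_on k (\<lambda>x. frechet_derivative f (at x within S) v) S)"

definition smooth_on ::
  "('a::real_normed_vector \<Rightarrow> 'b::real_normed_vector) \<Rightarrow> 'a set \<Rightarrow> bool" where
  "smooth_on f S \<longleftrightarrow> (\<forall>k. C_k_on k f S)"

text \<open>A chart is a pair of its domain and its coordinate map; the latter is only meaningful on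
  the domain.\<close>

type_synonym ('a, 'e) chart = "'a set \<times> ('a \<Rightarrow> 'e)"

text \<open>
  The manifold is the whole type \<open>'a\<close>; its topology is Hausdorff and second countable by the
  class constraints wherever this is required. Types of class \<open>euclidean_space\<close> have positive
  dimension, so zero-dimensional manifolds are covered by the second alternative of the
  condition on the chart images.
\<close>

definition smooth_atlas ::
  "('a::{t2_space, second_countable_topology}, 'e::euclidean_space) chart set \<Rightarrow> bool" where
  "smooth_atlas A \<longleftrightarrow>
     (\<Union>(U, c)\<in>A. U) = UNIV \<and>
     (\<forall>(U, c)\<in>A. open U \<and> homeomorphism U (c ` U) c (inv_into U c)) \<and>
     ((\<forall>(U, c)\<in>A. open (c ` U)) \<or> (\<forall>(U, c)\<in>A. c ` U \<subseteq> {0})) \<and>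
     (\<forall>(U, c)\<in>A. \<forall>(V, d)\<in>A. smooth_on (d \<circ> inv_into U c) (c ` (U \<inter> V)))"

definition prod_atlas ::
  "('a, 'e) chart set \<Rightarrow> ('b, 'f) chart set \<Rightarrow> ('a \<times> 'b, 'e \<times> 'f) chart set" where
  "prod_atlas A B = {(U \<times> V, map_prod c d) | U c V d. (U, c) \<in> A \<and> (V, d) \<in> B}"

definition smooth_map ::
  "('a::topological_space, 'e::real_normed_vector) chart set \<Rightarrow>
   ('b::topological_space, 'f::real_normed_vector) chart set \<Rightarrow> ('a \<Rightarrow> 'b) \<Rightarrow> bool" where
  "smooth_map A B F \<longleftrightarrow>
     continuous_on UNIV F \<and>
     (\<forall>(U, c)\<in>A. \<forall>(V, d)\<in>B. smooth_on (d \<circ> F \<circ> inv_into U c) (c ` (U \<inter> F -` V)))"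


section \<open>Tangent vectors and vector fields\<close>

definition smooth_fun_on ::
  "('a, 'e::real_normed_vector) chart set \<Rightarrow> 'a set \<Rightarrow> ('a \<Rightarrow> real) \<Rightarrow> bool" where
  "smooth_fun_on A W f \<longleftrightarrow> (\<forall>(U, c)\<in>A. smooth_on (f \<circ> inv_into U c) (c ` (U \<inter> W)))"

definition smooth_fun_at ::
  "('a::topological_space, 'e::real_normed_vector) chart set \<Rightarrow> 'a \<Rightarrow> ('a \<Rightarrow> real) \<Rightarrow> bool" where
  "smooth_fun_at A p f \<longleftrightarrow> (\<exists>W. open W \<and> p \<in> W \<and> smooth_fun_on A W f)"

text \<open>
  Tangent vectors at \<open>p\<close> are the derivations of the functions that are smooth near \<open>p\<close>. They
  only depend on the germ of the function at \<open>p\<close>: if \<open>f\<close> vanishes on an open neighbourhood \<open>W\<close>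
  of \<open>p\<close>, then \<open>f = f h\<close> for the indicator function \<open>h\<close> of \<open>- W\<close>, which is smooth near \<open>p\<close>,
  and \<open>f p = h p = 0\<close>. The value \<open>0\<close> on all other functions makes tangent vectors unique as
  HOL functions.
\<close>

definition tangent_space ::
  "('a::topological_space, 'e::real_normed_vector) chart set \<Rightarrow> 'a \<Rightarrow>
   (('a \<Rightarrow> real) \<Rightarrow> real) set" where
  "tangent_space A p = {v.
     (\<forall>f g a b. smooth_fun_at A p f \<longrightarrow> smooth_fun_at A p g \<longrightarrow>
        v (\<lambda>x. a * f x + b * g x) = a * v f + b * v g) \<and>
     (\<forall>f g. smooth_fun_at A p f \<longrightarrow> smooth_fun_at A p g \<longrightarrow>
        v (\<lambda>x. f x * g x) = f p * v g + v f * g p) \<and>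
     (\<forall>f. \<not> smooth_fun_at A p f \<longrightarrow> v f = 0)}"

type_synonym 'a vfield = "'a \<Rightarrow> ('a \<Rightarrow> real) \<Rightarrow> real"

definition smooth_vector_fields ::
  "('a::topological_space, 'e::real_normed_vector) chart set \<Rightarrow> 'a vfield set" where
  "smooth_vector_fields A = {X.
     (\<forall>p. X p \<in> tangent_space A p) \<and>
     (\<forall>W f. open W \<longrightarrow> smooth_fun_on A W f \<longrightarrow> smooth_fun_on A W (\<lambda>p. X p f))}"

definition vfield_bracket ::
  "('a::topological_space, 'e::real_normed_vector) chart set \<Rightarrow>
   'a vfield \<Rightarrow> 'a vfield \<Rightarrow> 'a vfield" where
  "vfield_bracket A X Y = (\<lambda>p f.
     if smooth_fun_at A p f then X p (\<lambda>q. Y q f) - Y p (\<lambda>q. X q f) else 0)"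

definition is_flow ::
  "('a::topological_space, 'e::real_normed_vector) chart set \<Rightarrow> 'a vfield \<Rightarrow>
   (real \<Rightarrow> 'a \<Rightarrow> 'a) \<Rightarrow> bool" where
  "is_flow A X \<phi> \<longleftrightarrow>
     (\<forall>x. \<phi> 0 x = x) \<and>
     (\<forall>x t f. smooth_fun_at A (\<phi> t x) f \<longrightarrow>
        ((\<lambda>s. f (\<phi> s x)) has_real_derivative X (\<phi> t x) f) (at t))"


section \<open>Semisimple Lie algebras of vector fields\<close>

definition zero_vfield :: "'a vfield" where
  "zero_vfield = (\<lambda>p f. 0)"

definition vfield_subspace :: "'a vfield set \<Rightarrow> bool" where
  "vfield_subspace S \<longleftrightarrow>
     zero_vfield \<in> S \<and>
     (\<forall>X\<in>S. \<forall>Y\<in>S. \<forall>a b. (\<lambda>p f. a * X p f + b * Y p f) \<in> S)"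

text \<open>For a Lie algebra \<open>L\<close>, this is \<open>[L, L]\<close>.\<close>

definition derived_algebra ::
  "('a::topological_space, 'e::real_normed_vector) chart set \<Rightarrow>
   'a vfield set \<Rightarrow> 'a vfield set" where
  "derived_algebra A L =
     \<Inter>{S. vfield_subspace S \<and> (\<forall>X\<in>L. \<forall>Y\<in>L. vfield_bracket A X Y \<in> S)}"

definition solvable_algebra ::
  "('a::topological_space, 'e::real_normed_vector) chart set \<Rightarrow> 'a vfield set \<Rightarrow> bool" where
  "solvable_algebra A L \<longleftrightarrow> (\<exists>n. (derived_algebra A ^^ n) L = {zero_vfield})"

definition lie_ideal ::
  "('a::topological_space, 'e::real_normed_vector) chart set \<Rightarrow>
   'a vfield set \<Rightarrow> 'a vfield set \<Rightarrow> bool" where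
  "lie_ideal A L I \<longleftrightarrow>
     vfield_subspace I \<and> I \<subseteq> L \<and> (\<forall>X\<in>L. \<forall>Y\<in>I. vfield_bracket A X Y \<in> I)"

text \<open>Equivalently, the radical is zero.\<close>

definition semisimple_algebra ::
  "('a::topological_space, 'e::real_normed_vector) chart set \<Rightarrow> 'a vfield set \<Rightarrow> bool" where
  "semisimple_algebra A L \<longleftrightarrow>
     (\<forall>I. lie_ideal A L I \<longrightarrow> solvable_algebra A I \<longrightarrow> I = {zero_vfield})"


section \<open>Lie groups and linear vector fields\<close>

locale lie_group = group G
  for G :: "'a::{t2_space, second_countable_topology} monoid" (structure)
    and A :: "('a, 'e::euclidean_space) chart set" +
  assumes carrier_UNIV: "carrier G = UNIV"
    and atlas: "smooth_atlas A"
    and smooth_mult: "smooth_map (prod_atlas A A) A (\<lambda>(x, y). x \<otimes> y)"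
    and smooth_inv: "smooth_map A A (\<lambda>x. inv x)"

definition lie_algebra ::
  "('a::topological_space) monoid \<Rightarrow> ('a, 'e::real_normed_vector) chart set \<Rightarrow>
   'a vfield set" where
  "lie_algebra G A = {X \<in> smooth_vector_fields A.
     \<forall>g h f. smooth_fun_at A (g \<otimes>\<^bsub>G\<^esub> h) f \<longrightarrow> X (g \<otimes>\<^bsub>G\<^esub> h) f = X h (\<lambda>x. f (g \<otimes>\<^bsub>G\<^esub> x))}"

definition semisimple_lie_group ::
  "('a::topological_space) monoid \<Rightarrow> ('a, 'e::real_normed_vector) chart set \<Rightarrow> bool" where
  "semisimple_lie_group G A \<longleftrightarrow> semisimple_algebra A (lie_algebra G A)"

definition lie_automorphisms ::
  "('a::topological_space) monoid \<Rightarrow> ('a, 'e::real_normed_vector) chart set \<Rightarrow>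
   ('a \<Rightarrow> 'a) set" where
  "lie_automorphisms G A =
     {F \<in> iso G G. smooth_map A A F \<and> smooth_map A A (inv_into (carrier G) F)}"

text \<open>\<open>X\<close> is a linear vector field and \<open>\<phi>\<close> is its linear flow.\<close>

definition linear_vector_field ::
  "('a::topological_space) monoid \<Rightarrow> ('a, 'e::real_normed_vector) chart set \<Rightarrow>
   'a vfield \<Rightarrow> (real \<Rightarrow> 'a \<Rightarrow> 'a) \<Rightarrow> bool" where
  "linear_vector_field G A X \<phi> \<longleftrightarrow>
     X \<in> smooth_vector_fields A \<and> is_flow A X \<phi> \<and> (\<forall>t. \<phi> t \<in> lie_automorphisms G A)"

definition fixed_point :: "(real \<Rightarrow> 'a \<Rightarrow> 'a) \<Rightarrow> 'a \<Rightarrow> bool" where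
  "fixed_point \<phi> g \<longleftrightarrow> (\<forall>t. \<phi> t g = g)"

definition stable_point :: "(real \<Rightarrow> 'a::topological_space \<Rightarrow> 'a) \<Rightarrow> 'a \<Rightarrow> bool" where
  "stable_point \<phi> g \<longleftrightarrow>
     (\<forall>U. open U \<and> g \<in> U \<longrightarrow> (\<exists>V. open V \<and> g \<in> V \<and> (\<forall>t\<ge>0. \<phi> t ` V \<subseteq> U)))"

end

theory Submission
  imports Defs
begin

text \<open>
  The function \<open>g \<mapsto> tr (Ad g)\<close> is invariant under every automorphism \<open>F\<close> of \<open>G\<close>, because
  \<open>Ad (F g)\<close> is conjugate to \<open>Ad g\<close> by the differential of \<open>F\<close> at \<open>\<one>\<close>. As \<open>G\<close> is compact, every
  \<open>Ad g\<close> has bounded powers and is therefore an isometry for some inner product; hence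
  \<open>tr (Ad g) \<le> dim G\<close>, with equality iff \<open>Ad g = id\<close>. Semisimplicity makes \<open>\<one>\<close> isolated in the
  kernel of \<open>Ad\<close>: a direction along which kernel elements approach \<open>\<one>\<close> would span a central, hence
  solvable, ideal of the Lie algebra. So if \<open>W\<close> is a small neighbourhood of \<open>\<one>\<close>, the trace stays
  below some \<open>m < dim G\<close> on the frontier of \<open>W\<close>, and an orbit starting in
  \<open>{g \<in> W. tr (Ad g) > m}\<close>, along which the trace is constant, can never leave \<open>W\<close>. Left
  translation moves the argument from \<open>\<one>\<close> to an arbitrary fixed point.
\<close>


section \<open>Smooth maps on open sets\<close>

text \<open>One chart \<open>c\<close> at the identity identifies the Lie algebra with
  \<open>'e\<close>, but semisimplicity is stated for ideals of vector fields acting as derivations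
  on germs. To use it, a chart direction \<open>v\<close> has to become a field whose bracket with
  every left-invariant field is known. That requires every left-invariant field to come from a
  vector \<open>w\<close>, which is where Hadamard's lemma with smooth coefficients enters. The
  brackets are then second derivatives of \<open>h (y x)\<close> at the identity, which is where the
  symmetry of second derivatives enters. The inner product preserved by a single \<open>Ad g\<close>
  arises from averages over the powers of \<open>Ad g\<close>, so nothing is integrated over the
  group. The approaching direction is a limit of normalised chart differences; compactness of the
  unit sphere provides it and keeps it nonzero. The flow is given only by integral curves tested on
  germs. Its continuity in time is extracted from that, since leaving a neighbourhood forces a
  crossing of the frontier only for a continuous orbit. Zero-dimensional charts are treated apart:
  there the points are open.\<close>

lemma C_k_on_cong:
  assumes "\<And>x. x \<in> S \<Longrightarrow> f x = g x"
  shows "C_k_on k f S \<longleftrightarrow> C_k_on k g S"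
  using assms
proof (induction k arbitrary: f g)
  case 0
  then show ?case by (simp cong: continuous_on_cong)
next
  case (Suc k)
  have der: "(f has_derivative F) (at x within S) \<longleftrightarrow> (g has_derivative F) (at x within S)"
    if "x \<in> S" for x F
    using Suc.prems has_derivative_transform[OF that] by metis
  \<comment> \<open>\<open>frechet_derivative\<close> picks a derivative by choice. Two maps with
    the same set of derivatives therefore get the same pick, whether or not a derivative exists or
    is unique.\<close>
  have fre: "frechet_derivative f (at x within S) = frechet_derivative g (at x within S)"
    if "x \<in> S" for x
    unfolding frechet_derivative_def using der[OF that] by simp
  have diff: "f differentiable (at x within S) \<longleftrightarrow> g differentiable (at x within S)" if "x \<in> S" for x
    unfolding differentiable_def using der[OF that] by simp
  have "C_k_on k (\<lambda>x. frechet_derivative f (at x within S) v) S \<longleftrightarrow>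
        C_k_on k (\<lambda>x. frechet_derivative g (at x within S) v) S" for v
    by (rule Suc.IH) (simp add: fre)
  with diff show ?case by auto
qed

lemma C_k_on_Suc_open:
  assumes "open S"
  shows "C_k_on (Suc k) f S \<longleftrightarrow>
     (\<forall>x\<in>S. f differentiable (at x)) \<and> (\<forall>v. C_k_on k (\<lambda>x. frechet_derivative f (at x) v) S)"
proof -
  have "at x within S = at x" if "x \<in> S" for x
    using assms that by (rule at_within_open[rotated])
  moreover from this have
    "C_k_on k (\<lambda>x. frechet_derivative f (at x within S) v) S \<longleftrightarrow>
     C_k_on k (\<lambda>x. frechet_derivative f (at x) v) S" for v
    by (intro C_k_on_cong) simp
  ultimately show ?thesis by simp
qed

text \<open>Derivatives at interior points are unique, so an explicit formula \<open>f'\<close> may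
  replace the chosen derivative. All closure properties below are proved by induction through this
  rule.\<close>

lemma C_k_on_SucI:
  assumes "open S" and der: "\<And>x. x \<in> S \<Longrightarrow> (f has_derivative f' x) (at x)"
    and "\<And>v. C_k_on k (\<lambda>x. f' x v) S"
  shows "C_k_on (Suc k) f S"
proof -
  have "C_k_on k (\<lambda>x. frechet_derivative f (at x) v) S \<longleftrightarrow> C_k_on k (\<lambda>x. f' x v) S" for v
    using frechet_derivative_at[OF der] by (intro C_k_on_cong) simp
  then show ?thesis
    using assms by (auto simp: C_k_on_Suc_open differentiable_def simp del: C_k_on.simps)
qed

lemma C_k_on_SucD:
  assumes "C_k_on (Suc k) f S" "open S"
  shows "\<And>x. x \<in> S \<Longrightarrow> (f has_derivative frechet_derivative f (at x)) (at x)"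
    and "C_k_on k (\<lambda>x. frechet_derivative f (at x) v) S"
  using assms by (auto simp: C_k_on_Suc_open frechet_derivative_works simp del: C_k_on.simps)

lemma C_k_on_Suc_lower: "open S \<Longrightarrow> C_k_on (Suc k) f S \<Longrightarrow> C_k_on k f S"
proof (induction k arbitrary: f)
  case 0
  then have "\<And>x. x \<in> S \<Longrightarrow> isCont f x"
    using C_k_on_SucD(1)[OF 0(2,1)] has_derivative_continuous by blast
  then show ?case by (simp add: continuous_at_imp_continuous_on)
next
  case (Suc k)
  show ?case
    by (rule C_k_on_SucI[OF Suc.prems(1) C_k_on_SucD(1)[OF Suc.prems(2,1)]])
       (use Suc C_k_on_SucD(2)[OF Suc.prems(2,1)] in blast)+
qed

lemma C_k_on_subset: "C_k_on k f S \<Longrightarrow> open S \<Longrightarrow> open T \<Longrightarrow> T \<subseteq> S \<Longrightarrow> C_k_on k f T"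
proof (induction k arbitrary: f)
  case 0
  then show ?case by (auto intro: continuous_on_subset)
next
  case (Suc k)
  show ?case
    by (rule C_k_on_SucI[OF Suc.prems(3) C_k_on_SucD(1)[OF Suc.prems(1,2)]])
       (use Suc C_k_on_SucD(2)[OF Suc.prems(1,2)] in auto)
qed

lemma C_k_on_local:
  assumes "open S" "\<And>x. x \<in> S \<Longrightarrow> \<exists>T. open T \<and> x \<in> T \<and> C_k_on k f T"
  shows "C_k_on k f S"
  using assms
proof (induction k arbitrary: f)
  case 0
  then have "isCont f x" if "x \<in> S" for x
    using that by (metis C_k_on.simps(1) continuous_on_eq_continuous_at)
  then show ?case by (simp add: continuous_at_imp_continuous_on)
next
  case (Suc k)
  have "(f has_derivative frechet_derivative f (at x)) (at x)" if "x \<in> S" for x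
  proof -
    from Suc.prems(2) \<open>x \<in> S\<close> obtain T where "open T" "x \<in> T" "C_k_on (Suc k) f T" by blast
    then show ?thesis using C_k_on_SucD(1) by blast
  qed
  moreover have "C_k_on k (\<lambda>x. frechet_derivative f (at x) v) S" for v
  proof (rule Suc.IH[OF Suc.prems(1)])
    fix x assume "x \<in> S"
    then obtain T where "open T" "x \<in> T" "C_k_on (Suc k) f T" using Suc.prems(2) by blast
    then show "\<exists>T. open T \<and> x \<in> T \<and> C_k_on k (\<lambda>x. frechet_derivative f (at x) v) T"
      using C_k_on_SucD(2) by blast
  qed
  ultimately show ?case by (rule C_k_on_SucI[OF Suc.prems(1)])
qed

section \<open>Closure properties of C^k maps\<close>

lemma C_k_on_const: "open S \<Longrightarrow> C_k_on k (\<lambda>x. c) S"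
proof (induction k arbitrary: c)
  case (Suc k)
  show ?case by (rule C_k_on_SucI[where f' = "\<lambda>x v. 0"]) (use Suc in auto)
qed simp

lemma C_k_on_linear:
  assumes "bounded_linear h" "open S"
  shows "C_k_on k h S"
proof (cases k)
  case 0
  then show ?thesis using assms by (simp add: linear_continuous_on)
next
  case (Suc m)
  have "(h has_derivative h) (at x)" for x
    using assms(1) by (rule bounded_linear_imp_has_derivative)
  then show ?thesis
    unfolding Suc using assms by (auto intro!: C_k_on_SucI C_k_on_const simp del: C_k_on.simps)
qed

lemma C_k_on_linear_compose:
  assumes "bounded_linear h" "open S" "C_k_on k f S"
  shows "C_k_on k (\<lambda>x. h (f x)) S"
  using assms(3)
proof (induction k arbitrary: f)
  case 0
  then show ?case using assms(1) by (simp add: bounded_linear.continuous_on)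
next
  case (Suc k)
  show ?case
    by (rule C_k_on_SucI[OF assms(2) bounded_linear.has_derivative[OF assms(1) C_k_on_SucD(1)[OF Suc.prems assms(2)]]])
       (use Suc.IH C_k_on_SucD(2)[OF Suc.prems assms(2)] in auto)
qed

lemma C_k_on_add:
  "open S \<Longrightarrow> C_k_on k f S \<Longrightarrow> C_k_on k g S \<Longrightarrow> C_k_on k (\<lambda>x. f x + g x) S"
proof (induction k arbitrary: f g)
  case 0
  then show ?case by (simp add: continuous_on_add)
next
  case (Suc k)
  show ?case
    by (rule C_k_on_SucI[OF Suc.prems(1) has_derivative_add[OF
          C_k_on_SucD(1)[OF Suc.prems(2,1)] C_k_on_SucD(1)[OF Suc.prems(3,1)]]])
       (use Suc.IH Suc.prems(1) C_k_on_SucD(2)[OF Suc.prems(2,1)] C_k_on_SucD(2)[OF Suc.prems(3,1)] in auto)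
qed

lemma C_k_on_sum:
  assumes "open S" "\<And>i. i \<in> I \<Longrightarrow> C_k_on k (f i) S"
  shows "C_k_on k (\<lambda>x. \<Sum>i\<in>I. f i x) S"
  using assms(2)
  by (induction I rule: infinite_finite_induct) (auto intro: C_k_on_const C_k_on_add assms(1))

lemma C_k_on_scaleR:
  assumes "open S"
  shows "C_k_on k f S \<Longrightarrow> C_k_on k g S \<Longrightarrow> C_k_on k (\<lambda>x. f x *\<^sub>R g x) S"
proof (induction k arbitrary: f g)
  case 0
  then show ?case by (simp add: continuous_on_scaleR)
next
  case (Suc k)
  \<comment> \<open>Each summand of the product rule keeps one factor undifferentiated, so both
    factors are also needed with order \<open>k\<close>.\<close>
  note lower = Suc.prems[THEN C_k_on_Suc_lower[OF assms]]
  note der = Suc.prems[THEN C_k_on_SucD(2)[OF _ assms]]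
  show ?case
    by (rule C_k_on_SucI[OF assms has_derivative_scaleR[OF
          C_k_on_SucD(1)[OF Suc.prems(1) assms] C_k_on_SucD(1)[OF Suc.prems(2) assms]]])
       (assumption | intro C_k_on_add assms Suc.IH lower der)+
qed

text \<open>The chain rule yields \<open>f' (g x) (g' x v)\<close>, where the direction fed to
  \<open>f'\<close> varies with \<open>x\<close>, while \<open>C_k_on\<close> controls derivatives
  only in fixed directions. Expanding the direction in the finite \<open>Basis\<close> turns this
  into a sum of products to which the induction hypothesis applies.\<close>

lemma C_k_on_compose:
  fixes g :: "'a::real_normed_vector \<Rightarrow> 'b::euclidean_space"
  assumes "open S" "open T" "g ` S \<subseteq> T"
  shows "C_k_on k f T \<Longrightarrow> C_k_on k g S \<Longrightarrow> C_k_on k (\<lambda>x. f (g x)) S"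
proof (induction k arbitrary: f)
  case 0
  then show ?case using assms(3) by (auto intro: continuous_on_compose2)
next
  case (Suc k)
  let ?f' = "\<lambda>x. frechet_derivative f (at x)" and ?g' = "\<lambda>x. frechet_derivative g (at x)"
  have f': "(f has_derivative ?f' y) (at y)" if "y \<in> T" for y
    using C_k_on_SucD(1)[OF Suc.prems(1) assms(2)] that .
  have lin: "?f' y v = (\<Sum>b\<in>Basis. (v \<bullet> b) *\<^sub>R ?f' y b)" if "y \<in> T" for y v
  proof -
    have "?f' y v = ?f' y (\<Sum>b\<in>Basis. (v \<bullet> b) *\<^sub>R b)"
      by (simp add: euclidean_representation)
    then show ?thesis
      using has_derivative_linear[OF f'[OF that]] by (simp add: linear_sum linear_cmul)
  qed
  have g: "C_k_on k g S"
    using C_k_on_Suc_lower assms(1) Suc.prems(2) by blast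
  have "C_k_on k (\<lambda>x. ?f' (g x) (?g' x v)) S \<longleftrightarrow>
        C_k_on k (\<lambda>x. \<Sum>b\<in>Basis. (?g' x v \<bullet> b) *\<^sub>R ?f' (g x) b) S" for v
    using assms(3) by (intro C_k_on_cong lin) auto
  moreover have "C_k_on k (\<lambda>x. \<Sum>b\<in>Basis. (?g' x v \<bullet> b) *\<^sub>R ?f' (g x) b) S" for v
    by (intro C_k_on_sum C_k_on_scaleR assms(1) Suc.IH g C_k_on_SucD(2)[OF Suc.prems(1) assms(2)]
          C_k_on_linear_compose[OF bounded_linear_inner_left _ C_k_on_SucD(2)[OF Suc.prems(2) assms(1)]])
  moreover have "((\<lambda>x. f (g x)) has_derivative (\<lambda>v. ?f' (g x) (?g' x v))) (at x)" if "x \<in> S" for x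
    using diff_chain_at[OF C_k_on_SucD(1)[OF Suc.prems(2) assms(1) that] f'] that assms(3)
    by (auto simp: o_def)
  ultimately show ?case by (intro C_k_on_SucI[OF assms(1)]) auto
qed

lemma smooth_on_cong:
  "(\<And>x. x \<in> S \<Longrightarrow> f x = g x) \<Longrightarrow> smooth_on f S \<longleftrightarrow> smooth_on g S"
  unfolding smooth_on_def using C_k_on_cong by blast

lemma smooth_on_subset: "smooth_on f S \<Longrightarrow> open S \<Longrightarrow> open T \<Longrightarrow> T \<subseteq> S \<Longrightarrow> smooth_on f T"
  unfolding smooth_on_def using C_k_on_subset by blast

lemma smooth_on_local:
  assumes "open S" "\<And>x. x \<in> S \<Longrightarrow> \<exists>T. open T \<and> x \<in> T \<and> smooth_on f T"
  shows "smooth_on f S"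
  using assms unfolding smooth_on_def by (metis C_k_on_local)

lemma smooth_on_const: "open S \<Longrightarrow> smooth_on (\<lambda>x. c) S"
  by (simp add: smooth_on_def C_k_on_const)

lemma smooth_on_linear: "bounded_linear h \<Longrightarrow> open S \<Longrightarrow> smooth_on h S"
  by (simp add: smooth_on_def C_k_on_linear)

lemma smooth_on_linear_compose:
  "bounded_linear h \<Longrightarrow> open S \<Longrightarrow> smooth_on f S \<Longrightarrow> smooth_on (\<lambda>x. h (f x)) S"
  by (simp add: smooth_on_def C_k_on_linear_compose)

lemma smooth_on_add:
  "open S \<Longrightarrow> smooth_on f S \<Longrightarrow> smooth_on g S \<Longrightarrow> smooth_on (\<lambda>x. f x + g x) S"
  by (simp add: smooth_on_def C_k_on_add)

lemma smooth_on_scaleR: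
  "open S \<Longrightarrow> smooth_on f S \<Longrightarrow> smooth_on g S \<Longrightarrow> smooth_on (\<lambda>x. f x *\<^sub>R g x) S"
  by (simp add: smooth_on_def C_k_on_scaleR)

lemma smooth_on_compose:
  fixes g :: "'a::real_normed_vector \<Rightarrow> 'b::euclidean_space"
  assumes "open S" "open T" "g ` S \<subseteq> T" "smooth_on f T" "smooth_on g S"
  shows "smooth_on (\<lambda>x. f (g x)) S"
  using assms(4,5) C_k_on_compose[OF assms(1-3)] unfolding smooth_on_def by blast

lemma smooth_on_Pair:
  assumes "open S" "smooth_on f S" "smooth_on g S"
  shows "smooth_on (\<lambda>x. (f x, g x)) S"
proof -
  have "bounded_linear (\<lambda>x. (x, 0))" "bounded_linear (\<lambda>x. (0, x))"
    by (auto intro: bounded_linear_Pair bounded_linear_ident bounded_linear_zero)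
  from smooth_on_linear_compose[OF this(1) assms(1,2)] smooth_on_linear_compose[OF this(2) assms(1,3)]
  have "smooth_on (\<lambda>x. (f x, 0) + (0, g x)) S"
    by (intro smooth_on_add assms(1))
  then show ?thesis by simp
qed

lemma smooth_on_has_derivative:
  assumes "smooth_on f S" "open S" "x \<in> S"
  shows "(f has_derivative frechet_derivative f (at x)) (at x)"
  using assms C_k_on_SucD(1) unfolding smooth_on_def by blast

lemma smooth_on_derivative:
  assumes "smooth_on f S" "open S"
  shows "smooth_on (\<lambda>x. frechet_derivative f (at x) v) S"
  using assms C_k_on_SucD(2) unfolding smooth_on_def by blast

lemma smooth_on_continuous: "smooth_on f S \<Longrightarrow> continuous_on S f"
  unfolding smooth_on_def using C_k_on.simps(1) by blast

section \<open>Symmetry of second derivatives and Hadamard's lemma\<close>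

lemma has_real_derivative_line:
  assumes "(f has_derivative F) (at (w + t *\<^sub>R u))"
  shows "((\<lambda>s. f (w + s *\<^sub>R u)) has_real_derivative F u) (at t)"
proof -
  have "((\<lambda>s. w + s *\<^sub>R u) has_derivative (\<lambda>h. h *\<^sub>R u)) (at t)"
    by (auto intro!: derivative_eq_intros)
  from diff_chain_at[OF this assms] have "((\<lambda>s. f (w + s *\<^sub>R u)) has_derivative (\<lambda>h. F (h *\<^sub>R u))) (at t)"
    by (simp add: o_def)
  moreover have "F (h *\<^sub>R u) = F u * h" for h
    using has_derivative_linear[OF assms] by (simp add: linear_cmul mult.commute)
  ultimately show ?thesis by (simp add: has_field_derivative_def)
qed

text \<open>The mean value theorem is applied twice, first along \<open>u\<close> to a difference in
  direction \<open>v\<close>, then along \<open>v\<close> to the derivative in direction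
  \<open>u\<close>. The point \<open>q\<close> collects the two intermediate values.\<close>

lemma mixed_difference:
  fixes f :: "'a::real_normed_vector \<Rightarrow> real"
  assumes "smooth_on f (ball p r)" "0 < s" "s * (norm u + norm v) < r"
  obtains q where "dist p q \<le> s * (norm u + norm v)"
    "f (p + s *\<^sub>R u + s *\<^sub>R v) - f (p + s *\<^sub>R u) - f (p + s *\<^sub>R v) + f p =
      s * s * frechet_derivative (\<lambda>x. frechet_derivative f (at x) u) (at q) v"
proof -
  let ?d = "\<lambda>x. frechet_derivative f (at x) u"
  let ?dd = "\<lambda>x. frechet_derivative ?d (at x) v"
  have near: "norm (a *\<^sub>R u + b *\<^sub>R v) \<le> s * (norm u + norm v)"
    if "0 \<le> a" "a \<le> s" "0 \<le> b" "b \<le> s" for a b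
  proof -
    have "norm (a *\<^sub>R u + b *\<^sub>R v) \<le> a * norm u + b * norm v"
      using norm_triangle_ineq[of "a *\<^sub>R u" "b *\<^sub>R v"] that by simp
    also have "\<dots> \<le> s * norm u + s * norm v"
      using that by (intro add_mono mult_right_mono) auto
    finally show ?thesis by (simp add: algebra_simps)
  qed
  have dist: "dist p (p + a *\<^sub>R u + b *\<^sub>R v) = norm (a *\<^sub>R u + b *\<^sub>R v)" for a b
    by (metis add.assoc add_diff_cancel_left' dist_norm norm_minus_commute)
  have mem: "p + a *\<^sub>R u + b *\<^sub>R v \<in> ball p r" if "0 \<le> a" "a \<le> s" "0 \<le> b" "b \<le> s" for a b
    using near[OF that] assms(3) by (simp add: dist)
  have f': "(f has_derivative frechet_derivative f (at x)) (at x)" if "x \<in> ball p r" for x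
    using smooth_on_has_derivative[OF assms(1)] that by simp
  have f'': "(?d has_derivative frechet_derivative ?d (at x)) (at x)" if "x \<in> ball p r" for x
    using smooth_on_has_derivative[OF smooth_on_derivative[OF assms(1)]] that by simp
  \<comment> \<open>Chosen so that \<open>g s - g 0\<close> is the second difference in the
    conclusion.\<close>
  define g where "g = (\<lambda>t. f ((p + s *\<^sub>R v) + t *\<^sub>R u) - f (p + t *\<^sub>R u))"
  have "(g has_real_derivative ?d ((p + s *\<^sub>R v) + t *\<^sub>R u) - ?d (p + t *\<^sub>R u)) (at t)"
    if "0 \<le> t" "t \<le> s" for t
    unfolding g_def using mem[of t s] mem[of t 0] that assms(2)
    by (intro derivative_intros has_real_derivative_line f') (auto simp: algebra_simps)
  from MVT2[OF assms(2) this] obtain t where t: "0 < t" "t < s"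
    and gt: "g s - g 0 = (s - 0) * (?d ((p + s *\<^sub>R v) + t *\<^sub>R u) - ?d (p + t *\<^sub>R u))"
    by blast
  define k where "k = (\<lambda>b. ?d ((p + t *\<^sub>R u) + b *\<^sub>R v))"
  have "(k has_real_derivative ?dd ((p + t *\<^sub>R u) + b *\<^sub>R v)) (at b)" if "0 \<le> b" "b \<le> s" for b
    unfolding k_def by (rule has_real_derivative_line[OF f'']) (use mem[of t b] that t in auto)
  from MVT2[OF assms(2) this] obtain b where b: "0 < b" "b < s"
    and kb: "k s - k 0 = (s - 0) * ?dd ((p + t *\<^sub>R u) + b *\<^sub>R v)"
    by blast
  have "g s - g 0 = s * s * ?dd ((p + t *\<^sub>R u) + b *\<^sub>R v)"
    using gt kb by (simp add: k_def algebra_simps)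
  moreover have "dist p (p + t *\<^sub>R u + b *\<^sub>R v) \<le> s * (norm u + norm v)"
    using near[of t b] t b by (simp add: dist)
  ultimately show thesis
    by (intro that) (auto simp: g_def algebra_simps)
qed

text \<open>The second difference is symmetric in \<open>u\<close> and \<open>v\<close>. Evaluating
  it in both orders at scales tending to zero gives equal mixed derivatives at points tending to
  \<open>p\<close>; continuity finishes.\<close>

lemma symmetric_second_derivative:
  fixes f :: "'a::real_normed_vector \<Rightarrow> real"
  assumes "smooth_on f S" "open S" "p \<in> S"
  shows "frechet_derivative (\<lambda>x. frechet_derivative f (at x) u) (at p) v =
         frechet_derivative (\<lambda>x. frechet_derivative f (at x) v) (at p) u"
proof -
  obtain r where r: "r > 0" "ball p r \<subseteq> S" using assms openE by blast
  have sm: "smooth_on f (ball p r)" using smooth_on_subset[OF assms(1,2)] r by simp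
  define D where "D = (\<lambda>u v q. frechet_derivative (\<lambda>x. frechet_derivative f (at x) u) (at q) v)"
  \<comment> \<open>The summand 1 keeps \<open>c\<close> positive when both directions vanish, and
    the factor 2 in \<open>s\<close> keeps all sample points inside the ball of radius
    \<open>r\<close>.\<close>
  define c where "c = norm u + norm v + 1"
  define s where "s = (\<lambda>n. (r / (2 * c)) * inverse (real (Suc n)))"
  have c: "c \<ge> 1" "norm u + norm v \<le> c" by (simp_all add: c_def)
  have s0: "0 < s n" for n using r c by (simp add: s_def)
  have s1: "s n * (norm u + norm v) \<le> (r / 2) * inverse (real (Suc n))" for n
  proof -
    have "s n * (norm u + norm v) \<le> s n * c" using c s0[of n] by (intro mult_left_mono) auto
    also have "\<dots> = (r / 2) * inverse (real (Suc n))" using c by (simp add: s_def)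
    finally show ?thesis .
  qed
  have s2: "s n * (norm u + norm v) < r" for n
  proof -
    have "(r / 2) * inverse (real (Suc n)) \<le> (r / 2) * 1"
      using r by (intro mult_left_mono) (auto simp: field_simps)
    with s1[of n] r show ?thesis by linarith
  qed
  have "\<exists>q q'. dist p q \<le> (r / 2) * inverse (real (Suc n)) \<and>
       dist p q' \<le> (r / 2) * inverse (real (Suc n)) \<and> D u v q = D v u q'" for n
  proof -
    obtain q where q: "dist p q \<le> s n * (norm u + norm v)"
      "f (p + s n *\<^sub>R u + s n *\<^sub>R v) - f (p + s n *\<^sub>R u) - f (p + s n *\<^sub>R v) + f p = s n * s n * D u v q"
      using mixed_difference[OF sm s0 s2] unfolding D_def by blast
    obtain q' where q': "dist p q' \<le> s n * (norm v + norm u)"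
      "f (p + s n *\<^sub>R v + s n *\<^sub>R u) - f (p + s n *\<^sub>R v) - f (p + s n *\<^sub>R u) + f p = s n * s n * D v u q'"
      using mixed_difference[OF sm s0, of n v u] s2[of n] unfolding D_def
      by (metis add.commute)
    have "s n * s n * D u v q = s n * s n * D v u q'"
      using q(2) q'(2) by (simp add: algebra_simps)
    then have "D u v q = D v u q'" using s0[of n] by simp
    then show ?thesis using q(1) q'(1) s1[of n] by (metis add.commute order_trans)
  qed
  then obtain q q' where
    q: "\<And>n. dist p (q n) \<le> (r / 2) * inverse (real (Suc n))" and
    q': "\<And>n. dist p (q' n) \<le> (r / 2) * inverse (real (Suc n))" and
    eq: "\<And>n. D u v (q n) = D v u (q' n)" by metis
  have null: "(\<lambda>n. (r / 2) * inverse (real (Suc n))) \<longlonglongrightarrow> 0"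
    using tendsto_mult[OF tendsto_const LIMSEQ_inverse_real_of_nat] by simp
  have lim: "x \<longlonglongrightarrow> p" if "\<And>n. dist p (x n) \<le> (r / 2) * inverse (real (Suc n))" for x :: "nat \<Rightarrow> 'a"
  proof -
    have "(\<lambda>n. dist (x n) p) \<longlonglongrightarrow> 0"
      by (rule tendsto_sandwich[OF _ _ tendsto_const null]) (use that in \<open>auto simp: dist_commute\<close>)
    then show ?thesis using tendsto_dist_iff by blast
  qed
  have cont: "isCont (D a b) p" for a b
    using smooth_on_continuous[OF smooth_on_derivative[OF smooth_on_derivative[OF assms(1,2)] assms(2)]]
      assms(2,3) unfolding D_def by (simp add: continuous_on_eq_continuous_at)
  have "(\<lambda>n. D u v (q n)) \<longlonglongrightarrow> D u v p" "(\<lambda>n. D v u (q' n)) \<longlonglongrightarrow> D v u p"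
    using isCont_tendsto_compose[OF cont] lim q q' by blast+
  then have "D u v p = D v u p" using eq LIMSEQ_unique by simp
  then show ?thesis by (simp add: D_def)
qed

section \<open>Hadamard's lemma with smooth coefficients\<close>

text \<open>Differentiation under the integral sign produces one factor \<open>t\<close> from the
  inner map. The weight \<open>t ^ j\<close> absorbs it, which makes the statement stable under the
  induction on \<open>k\<close>.\<close>

lemma C_k_on_segment_integral:
  fixes h :: "'a::euclidean_space \<Rightarrow> real"
  assumes "smooth_on h (ball a r)"
  shows "C_k_on k (\<lambda>x. integral {0..1} (\<lambda>t. t ^ j * h (a + t *\<^sub>R (x - a)))) (ball a r)"
  using assms
proof (induction k arbitrary: h j)
  case (0 h j)
  have mem: "a + t *\<^sub>R (x - a) \<in> ball a r" if "x \<in> ball a r" "t \<in> {0..1}" for x t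
  proof -
    have "t * norm (x - a) \<le> norm (x - a)" using that by (simp add: mult_left_le_one_le)
    then show ?thesis using that by (simp add: dist_norm norm_minus_commute)
  qed
  have "continuous_on (ball a r \<times> {0..1}) (\<lambda>(x, t). t ^ j * h (a + t *\<^sub>R (x - a)))"
    unfolding split_beta
    by (intro continuous_intros continuous_on_compose2[OF smooth_on_continuous[OF 0]])
       (use mem in auto)
  then show ?case
    using integral_continuous_on_param[of "ball a r" 0 "1::real"] by simp
next
  case (Suc k h j)
  let ?h' = "\<lambda>x. frechet_derivative h (at x)"
  have h': "(h has_derivative ?h' x) (at x)" if "x \<in> ball a r" for x
    using smooth_on_has_derivative[OF Suc.prems] that by simp
  have mem: "a + t *\<^sub>R (x - a) \<in> ball a r" if "x \<in> ball a r" "t \<in> {0..1}" for x t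
  proof -
    have "t * norm (x - a) \<le> norm (x - a)" using that by (simp add: mult_left_le_one_le)
    then show ?thesis using that by (simp add: dist_norm norm_minus_commute)
  qed
  \<comment> \<open>The Leibniz rule for parameter integrals takes the derivative as an element of
    the normed space of bounded linear maps.\<close>
  define D where "D = (\<lambda>x t. Blinfun (\<lambda>v. t ^ Suc j * ?h' (a + t *\<^sub>R (x - a)) v))"
  have D: "blinfun_apply (D x t) v = t ^ Suc j * ?h' (a + t *\<^sub>R (x - a)) v"
    if "x \<in> ball a r" "t \<in> {0..1}" for x t v
    unfolding D_def using has_derivative_bounded_linear[OF h'[OF mem[OF that]]]
    by (subst bounded_linear_Blinfun_apply) (auto intro: bounded_linear_mult_left bounded_linear_const_mult)
  have der: "((\<lambda>x. t ^ j * h (a + t *\<^sub>R (x - a))) has_derivative D x t) (at x within ball a r)"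
    if x: "x \<in> ball a r" and t: "t \<in> cbox 0 1" for x t
  proof -
    have "((\<lambda>x. a + t *\<^sub>R (x - a)) has_derivative (\<lambda>v. t *\<^sub>R v)) (at x)"
      by (auto intro!: derivative_eq_intros simp: algebra_simps)
    from diff_chain_at[OF this h'[OF mem]] x t
    have "((\<lambda>x. h (a + t *\<^sub>R (x - a))) has_derivative (\<lambda>v. ?h' (a + t *\<^sub>R (x - a)) (t *\<^sub>R v))) (at x)"
      by (simp add: o_def)
    from has_derivative_mult_right[OF this, of "t ^ j"]
    have "((\<lambda>x. t ^ j * h (a + t *\<^sub>R (x - a))) has_derivative
            (\<lambda>v. t ^ j * ?h' (a + t *\<^sub>R (x - a)) (t *\<^sub>R v))) (at x)" .
    moreover have "(\<lambda>v. t ^ j * ?h' (a + t *\<^sub>R (x - a)) (t *\<^sub>R v)) = D x t"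
      using D[OF x] t has_derivative_linear[OF h'[OF mem[OF x]]]
      by (auto simp: linear_cmul)
    ultimately show ?thesis using has_derivative_at_withinI by metis
  qed
  have contD: "continuous_on (ball a r \<times> {0..1}) (\<lambda>(x, t). t ^ Suc j * ?h' (a + t *\<^sub>R (x - a)) v)" for v
    unfolding split_beta
    by (intro continuous_intros continuous_on_compose2[OF smooth_on_continuous[OF smooth_on_derivative[OF Suc.prems open_ball]]])
       (use mem in auto)
  \<comment> \<open>Smoothness of \<open>h\<close> gives continuity for each fixed direction; on a
    finite-dimensional domain this yields continuity in the operator norm.\<close>
  have cont: "continuous_on (ball a r \<times> cbox 0 1) (\<lambda>(x, t). D x t)"
  proof (rule continuous_on_blinfun_componentwise)
    fix i :: 'a
    have "continuous_on (ball a r \<times> cbox 0 1) (\<lambda>z. blinfun_apply (case z of (x, t) \<Rightarrow> D x t) i) \<longleftrightarrow>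
          continuous_on (ball a r \<times> {0..1}) (\<lambda>(x, t). t ^ Suc j * ?h' (a + t *\<^sub>R (x - a)) i)"
      by (intro continuous_on_cong) (auto simp: D simp del: power_Suc)
    then show "continuous_on (ball a r \<times> cbox 0 1) (\<lambda>z. blinfun_apply (case z of (x, t) \<Rightarrow> D x t) i)"
      using contD by simp
  qed
  have conth: "continuous_on {0..1} (\<lambda>t. t ^ j * h (a + t *\<^sub>R (x - a)))" if "x \<in> ball a r" for x
    by (intro continuous_intros continuous_on_compose2[OF smooth_on_continuous[OF Suc.prems]])
       (use mem[OF that] in auto)
  have int: "((\<lambda>x. integral {0..1} (\<lambda>t. t ^ j * h (a + t *\<^sub>R (x - a)))) has_derivative
               integral {0..1} (D x)) (at x)" if "x \<in> ball a r" for x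
  proof -
    have "((\<lambda>x. integral (cbox 0 1) (\<lambda>t. t ^ j * h (a + t *\<^sub>R (x - a)))) has_derivative
               integral (cbox 0 1) (D x)) (at x within ball a r)"
    proof (rule leibniz_rule[OF der _ cont that convex_ball])
      fix x assume "x \<in> ball a r"
      then show "(\<lambda>t. t ^ j * h (a + t *\<^sub>R (x - a))) integrable_on cbox 0 1"
        unfolding box_real by (rule integrable_continuous_interval[OF conth])
    qed
    then show ?thesis unfolding at_within_open[OF that open_ball] box_real .
  qed
  have "blinfun_apply (integral {0..1} (D x)) v =
        integral {0..1} (\<lambda>t. t ^ Suc j * ?h' (a + t *\<^sub>R (x - a)) v)" if "x \<in> ball a r" for x v
  proof -
    have "continuous_on {0..1} (\<lambda>t. case (x, t) of (x, t) \<Rightarrow> D x t)"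
      by (rule continuous_on_compose2[OF cont]) (use that in \<open>auto intro!: continuous_intros\<close>)
    then have "D x integrable_on {0..1}"
      by (simp add: integrable_continuous_interval)
    from integral_linear[OF this blinfun.bounded_linear_left[of v]]
    have "blinfun_apply (integral {0..1} (D x)) v = integral {0..1} (\<lambda>t. blinfun_apply (D x t) v)"
      by (simp add: o_def)
    also have "\<dots> = integral {0..1} (\<lambda>t. t ^ Suc j * ?h' (a + t *\<^sub>R (x - a)) v)"
      by (intro integral_cong D that)
    finally show ?thesis .
  qed
  then have "C_k_on k (\<lambda>x. blinfun_apply (integral {0..1} (D x)) v) (ball a r) \<longleftrightarrow>
     C_k_on k (\<lambda>x. integral {0..1} (\<lambda>t. t ^ Suc j * ?h' (a + t *\<^sub>R (x - a)) v)) (ball a r)" for v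
    by (intro C_k_on_cong)
  moreover have "C_k_on k (\<lambda>x. integral {0..1} (\<lambda>t. t ^ Suc j * ?h' (a + t *\<^sub>R (x - a)) v)) (ball a r)" for v
    by (intro Suc.IH smooth_on_derivative Suc.prems) simp
  ultimately show ?case
    by (intro C_k_on_SucI[OF open_ball int]) auto
qed

text \<open>The coefficients are the partial derivatives averaged over the segment from
  \<open>a\<close> to \<open>x\<close>, and the expansion is the fundamental theorem of calculus
  along that segment. Smooth coefficients allow a derivation to be applied to the expansion.\<close>

lemma hadamard_smooth:
  fixes f :: "'a::euclidean_space \<Rightarrow> real"
  assumes "smooth_on f (ball a r)" "0 < r"
  obtains g where "\<And>b. smooth_on (g b) (ball a r)"
    "\<And>b. g b a = frechet_derivative f (at a) b"
    "\<And>x. x \<in> ball a r \<Longrightarrow> f x = f a + (\<Sum>b\<in>Basis. ((x - a) \<bullet> b) * g b x)"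
proof
  let ?f' = "\<lambda>x. frechet_derivative f (at x)"
  let ?g = "\<lambda>b x. integral {0..1} (\<lambda>t. ?f' (a + t *\<^sub>R (x - a)) b)"
  show "smooth_on (?g b) (ball a r)" for b
    using C_k_on_segment_integral[OF smooth_on_derivative[OF assms(1) open_ball], where j=0]
    unfolding smooth_on_def by simp
  show "?g b a = ?f' a b" for b by simp
  fix x assume x: "x \<in> ball a r"
  have mem: "a + t *\<^sub>R (x - a) \<in> ball a r" if "t \<in> {0..1}" for t
  proof -
    have "t * norm (x - a) \<le> norm (x - a)" using that by (simp add: mult_left_le_one_le)
    then show ?thesis using x that by (simp add: dist_norm norm_minus_commute)
  qed
  have f': "(f has_derivative ?f' y) (at y)" if "y \<in> ball a r" for y
    using smooth_on_has_derivative[OF assms(1)] that by simp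
  have "((\<lambda>t. f (a + t *\<^sub>R (x - a))) has_vector_derivative ?f' (a + t *\<^sub>R (x - a)) (x - a))
          (at t within {0..1})" if "t \<in> {0..1}" for t
    using has_real_derivative_line[OF f'[OF mem[OF that]]]
    by (simp add: has_real_derivative_iff_has_vector_derivative has_vector_derivative_at_within)
  then have "((\<lambda>t. ?f' (a + t *\<^sub>R (x - a)) (x - a)) has_integral
     f (a + 1 *\<^sub>R (x - a)) - f (a + 0 *\<^sub>R (x - a))) {0..1}"
    by (intro fundamental_theorem_of_calculus) auto
  then have "f x - f a = integral {0..1} (\<lambda>t. ?f' (a + t *\<^sub>R (x - a)) (x - a))"
    by (simp add: integral_unique)
  also have "\<dots> = integral {0..1} (\<lambda>t. \<Sum>b\<in>Basis. ((x - a) \<bullet> b) * ?f' (a + t *\<^sub>R (x - a)) b)"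
  proof (rule integral_cong)
    fix t :: real assume t: "t \<in> {0..1}"
    have "?f' (a + t *\<^sub>R (x - a)) (x - a) =
          ?f' (a + t *\<^sub>R (x - a)) (\<Sum>b\<in>Basis. ((x - a) \<bullet> b) *\<^sub>R b)"
      by (simp add: euclidean_representation)
    also have "\<dots> = (\<Sum>b\<in>Basis. ((x - a) \<bullet> b) * ?f' (a + t *\<^sub>R (x - a)) b)"
      using has_derivative_linear[OF f'[OF mem[OF t]]]
      by (simp only: linear_sum linear_cmul real_scaleR_def)
    finally show "?f' (a + t *\<^sub>R (x - a)) (x - a) = \<dots>" .
  qed
  also have "\<dots> = (\<Sum>b\<in>Basis. ((x - a) \<bullet> b) * ?g b x)"
  proof -
    have "continuous_on {0..1} (\<lambda>t. ?f' (a + t *\<^sub>R (x - a)) b)" for b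
      by (intro continuous_intros continuous_on_compose2[OF smooth_on_continuous[OF smooth_on_derivative[OF assms(1) open_ball]]])
         (use mem in auto)
    then show ?thesis
      by (subst integral_sum)
         (auto intro!: integrable_continuous_interval continuous_intros)
  qed
  finally show "f x = f a + (\<Sum>b\<in>Basis. ((x - a) \<bullet> b) * ?g b x)" by simp
qed

section \<open>Traces of power-bounded linear maps\<close>

definition lin_trace :: "('a::euclidean_space \<Rightarrow> 'a) \<Rightarrow> real" where
  "lin_trace f = (\<Sum>b\<in>Basis. f b \<bullet> b)"

lemma lin_trace_id: "lin_trace (\<lambda>x::'a::euclidean_space. x) = DIM('a)"
  by (simp add: lin_trace_def)

lemma lin_trace_commute:
  fixes f g :: "'a::euclidean_space \<Rightarrow> 'a"
  assumes "linear f" "linear g"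
  shows "lin_trace (f \<circ> g) = lin_trace (g \<circ> f)"
proof -
  have expand: "lin_trace (f \<circ> g) = (\<Sum>b\<in>Basis. \<Sum>c\<in>Basis. (g b \<bullet> c) * (f c \<bullet> b))"
    if "linear f" for f g :: "'a \<Rightarrow> 'a"
  proof -
    have "f (g b) \<bullet> b = (\<Sum>c\<in>Basis. (g b \<bullet> c) * (f c \<bullet> b))" for b
    proof -
      have "f (g b) = f (\<Sum>c\<in>Basis. (g b \<bullet> c) *\<^sub>R c)" by (simp add: euclidean_representation)
      then show ?thesis using that by (simp add: linear_sum linear_cmul inner_sum_left)
    qed
    then show ?thesis by (simp add: lin_trace_def)
  qed
  show ?thesis
    unfolding expand[OF assms(1)] expand[OF assms(2)]
    by (subst sum.swap) (simp add: mult.commute)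
qed

text \<open>The form is a limit of averages of the inner products
  \<open>(A ^^ k) x \<bullet> (A ^^ k) y\<close>. The upper bound on the powers gives compactness,
  the lower bound makes the limit positive definite, and averaging makes it invariant.
  \<open>L\<close> represents the form through the standard inner product.\<close>

lemma invariant_form:
  fixes A :: "'a::euclidean_space \<Rightarrow> 'a"
  assumes "linear A" and C: "\<And>k x. norm ((A ^^ k) x) \<le> C * norm x"
    and low: "\<And>k x. norm x \<le> C * norm ((A ^^ k) x)" and "C > 0"
  obtains L where "linear L" "\<And>x y. L x \<bullet> y = L y \<bullet> x" "\<And>x. x \<noteq> 0 \<Longrightarrow> L x \<bullet> x > 0"
    "\<And>x y. L (A x) \<bullet> A y = L x \<bullet> y"
proof -
  have lin: "linear (A ^^ k)" for k
    by (induction k) (auto intro: linear_compose[unfolded o_def] assms(1) simp: o_def linear_ident)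
  \<comment> \<open>The adjoint moves both powers to one side, so that the averaged form is
    represented by a linear map and compactness can be used for linear maps.\<close>
  define T where "T = (\<lambda>n x. inverse (real (Suc n)) *\<^sub>R (\<Sum>k\<le>n. adjoint (A ^^ k) ((A ^^ k) x)))"
  have T: "T n x \<bullet> y = inverse (real (Suc n)) * (\<Sum>k\<le>n. (A ^^ k) x \<bullet> (A ^^ k) y)" for n x y
    by (simp add: T_def inner_sum_left inner_commute[of "adjoint _ _"] adjoint_works[OF lin] inner_commute[of _ "(A ^^ _) x"])
  have linT: "linear (T n)" for n
    unfolding T_def
    by (intro linear_compose_scale_right linear_compose_sum ballI
          linear_compose[OF lin adjoint_linear[OF lin], unfolded o_def])
  have abs_le: "\<bar>T n x \<bullet> y\<bar> \<le> (C\<^sup>2 * norm x) * norm y" for n x y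
  proof -
    have "\<bar>\<Sum>k\<le>n. (A ^^ k) x \<bullet> (A ^^ k) y\<bar> \<le> (\<Sum>k\<le>n. (C\<^sup>2 * norm x) * norm y)"
    proof (rule order_trans[OF sum_abs sum_mono])
      fix k
      have "\<bar>(A ^^ k) x \<bullet> (A ^^ k) y\<bar> \<le> norm ((A ^^ k) x) * norm ((A ^^ k) y)"
        by (rule Cauchy_Schwarz_ineq2)
      also have "\<dots> \<le> (C * norm x) * (C * norm y)"
        by (intro mult_mono C) (use \<open>C > 0\<close> in auto)
      finally show "\<bar>(A ^^ k) x \<bullet> (A ^^ k) y\<bar> \<le> (C\<^sup>2 * norm x) * norm y"
        by (simp add: power2_eq_square mult_ac)
    qed
    also have "\<dots> = real (Suc n) * ((C\<^sup>2 * norm x) * norm y)" by simp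
    finally show ?thesis
      unfolding T abs_mult by (simp add: field_simps)
  qed
  have norm_T: "norm (T n x) \<le> C\<^sup>2 * norm x" for n x
  proof (cases "T n x = 0")
    case False
    have "norm (T n x) * norm (T n x) \<le> (C\<^sup>2 * norm x) * norm (T n x)"
      using abs_le[of n x "T n x"] by (simp add: norm_eq_sqrt_inner)
    then show ?thesis using False by simp
  qed simp
  have blT: "bounded_linear (T n)" for n
    using linT linear_conv_bounded_linear by blast
  define B where "B = (\<lambda>n. Blinfun (T n))"
  have B: "blinfun_apply (B n) x = T n x" for n x
    by (simp add: B_def bounded_linear_Blinfun_apply[OF blT])
  have "norm (B n) \<le> C\<^sup>2" for n
    by (rule norm_blinfun_bound) (use norm_T in \<open>simp_all add: B\<close>)
  then have "bounded (range B)" by (auto simp: bounded_iff)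
  \<comment> \<open>Bounded linear maps between Euclidean spaces form a finite-dimensional space, so
    a subsequence converges in operator norm.\<close>
  then obtain L r where r: "strict_mono (r :: nat \<Rightarrow> nat)" and L: "(B \<circ> r) \<longlonglongrightarrow> L"
    using bounded_imp_convergent_subsequence by blast
  have lim: "(\<lambda>n. T (r n) x \<bullet> y) \<longlonglongrightarrow> blinfun_apply L x \<bullet> y" for x y
  proof -
    have "(\<lambda>n. blinfun_apply ((B \<circ> r) n) x \<bullet> y) \<longlonglongrightarrow> blinfun_apply L x \<bullet> y"
      by (intro tendsto_intros L)
    then show ?thesis by (simp add: B)
  qed
  show thesis
  proof
    show "linear (blinfun_apply L)"
      using blinfun.bounded_linear_right bounded_linear.linear by blast
    show "blinfun_apply L x \<bullet> y = blinfun_apply L y \<bullet> x" for x y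
      using lim[of x y] lim[of y x] LIMSEQ_unique by (simp add: T inner_commute[of "(_ ^^ _) x"])
    show "blinfun_apply L x \<bullet> x > 0" if "x \<noteq> 0" for x
    proof -
      have "T n x \<bullet> x \<ge> (norm x / C)\<^sup>2" for n
      proof -
        have "(\<Sum>k\<le>n. (norm x / C)\<^sup>2) \<le> (\<Sum>k\<le>n. (A ^^ k) x \<bullet> (A ^^ k) x)"
        proof (rule sum_mono)
          fix k
          have "norm x / C \<le> norm ((A ^^ k) x)" using low[of x k] \<open>C > 0\<close> by (simp add: field_simps)
          then have "(norm x / C)\<^sup>2 \<le> (norm ((A ^^ k) x))\<^sup>2"
            using \<open>C > 0\<close> by (intro power_mono) auto
          then show "(norm x / C)\<^sup>2 \<le> (A ^^ k) x \<bullet> (A ^^ k) x"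
            by (simp add: power2_norm_eq_inner)
        qed
        then have "real (Suc n) * (norm x / C)\<^sup>2 \<le> (\<Sum>k\<le>n. (A ^^ k) x \<bullet> (A ^^ k) x)" by simp
        then show ?thesis unfolding T by (simp add: field_simps)
      qed
      then have "blinfun_apply L x \<bullet> x \<ge> (norm x / C)\<^sup>2"
        by (intro LIMSEQ_le_const[OF lim]) auto
      moreover have "(norm x / C)\<^sup>2 > 0" using that \<open>C > 0\<close> by simp
      ultimately show ?thesis by linarith
    qed
    show "blinfun_apply L (A x) \<bullet> A y = blinfun_apply L x \<bullet> y" for x y
    proof -
      \<comment> \<open>Replacing \<open>x\<close>, \<open>y\<close> by their images shifts the
        index of the average by one. The sum telescopes, leaving two bounded terms divided by
        \<open>n + 1\<close>.\<close>
      have diff: "T n (A x) \<bullet> A y - T n x \<bullet> y =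
          inverse (real (Suc n)) * ((A ^^ Suc n) x \<bullet> (A ^^ Suc n) y - x \<bullet> y)" for n
      proof -
        let ?q = "\<lambda>k. (A ^^ k) x \<bullet> (A ^^ k) y"
        have "(\<Sum>k\<le>n. ?q (Suc k)) - (\<Sum>k\<le>n. ?q k) = ?q (Suc n) - ?q 0"
          by (induction n) auto
        moreover have "(A ^^ k) (A z) = (A ^^ Suc k) z" for k z by (simp add: funpow_swap1)
        ultimately show ?thesis
          unfolding T right_diff_distrib[symmetric] by simp
      qed
      have le: "norm (T n (A x) \<bullet> A y - T n x \<bullet> y) \<le> inverse (real (Suc n)) * ((C * norm x) * (C * norm y) + norm x * norm y)" for n
      proof -
        have "\<bar>(A ^^ Suc n) x \<bullet> (A ^^ Suc n) y\<bar> \<le> (C * norm x) * (C * norm y)"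
          by (rule order_trans[OF Cauchy_Schwarz_ineq2 mult_mono[OF C C]]) (use \<open>C > 0\<close> in auto)
        then have "\<bar>(A ^^ Suc n) x \<bullet> (A ^^ Suc n) y - x \<bullet> y\<bar> \<le> (C * norm x) * (C * norm y) + norm x * norm y"
          using Cauchy_Schwarz_ineq2[of x y] by linarith
        then show ?thesis unfolding diff real_norm_def abs_mult by (intro mult_mono) auto
      qed
      have "(\<lambda>n. inverse (real (Suc n)) * ((C * norm x) * (C * norm y) + norm x * norm y)) \<longlonglongrightarrow> 0"
        using tendsto_mult[OF LIMSEQ_inverse_real_of_nat tendsto_const] by simp
      then have "(\<lambda>n. T n (A x) \<bullet> A y - T n x \<bullet> y) \<longlonglongrightarrow> 0"
        by (rule Lim_null_comparison[OF always_eventually[OF allI[OF le]]])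
      from LIMSEQ_subseq_LIMSEQ[OF this r]
      have "(\<lambda>n. T (r n) (A x) \<bullet> A y - T (r n) x \<bullet> y) \<longlonglongrightarrow> 0" by (simp add: o_def)
      from LIMSEQ_unique[OF this tendsto_diff[OF lim lim]] show ?thesis by simp
    qed
  qed
qed

text \<open>A finite set orthonormal for the form is independent, hence of cardinality at most the
  dimension, so a largest one exists. If it missed some \<open>x\<close>, the normalised remainder
  of the projection of \<open>x\<close> could be added to it.\<close>

lemma orthonormal_basis_form:
  fixes L :: "'a::euclidean_space \<Rightarrow> 'a"
  assumes "linear L" and sym: "\<And>x y. L x \<bullet> y = L y \<bullet> x" and pos: "\<And>x. x \<noteq> 0 \<Longrightarrow> L x \<bullet> x > 0"
  obtains B where "finite B" "card B \<le> DIM('a)" "\<And>b. b \<in> B \<Longrightarrow> L b \<bullet> b = 1"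
    "\<And>x. x = (\<Sum>b\<in>B. (L x \<bullet> b) *\<^sub>R b)"
proof -
  define P where "P = (\<lambda>B. finite B \<and> (\<forall>b\<in>B. \<forall>c\<in>B. L b \<bullet> c = (if b = c then 1 else 0)))"
  have coord: "L (\<Sum>b\<in>B. u b *\<^sub>R b) \<bullet> c = u c" if "P B" "c \<in> B" for B c and u :: "'a \<Rightarrow> real"
  proof -
    have "L (\<Sum>b\<in>B. u b *\<^sub>R b) \<bullet> c = (\<Sum>b\<in>B. u b * (L b \<bullet> c))"
      using assms(1) by (simp add: linear_sum linear_cmul inner_sum_left)
    also have "\<dots> = (\<Sum>b\<in>B. if b = c then u b else 0)"
      using that by (intro sum.cong) (auto simp: P_def)
    also have "\<dots> = u c" using that by (simp add: P_def)
    finally show ?thesis .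
  qed
  have card: "card B \<le> DIM('a)" if "P B" for B
  proof -
    have "independent B"
    proof (rule independent_if_scalars_zero)
      show "finite B" using that by (simp add: P_def)
      fix u :: "'a \<Rightarrow> real" and c assume "(\<Sum>b\<in>B. u b *\<^sub>R b) = 0" "c \<in> B"
      then show "u c = 0" using coord[OF that, of c u] assms(1) by (simp add: linear_0)
    qed
    then show ?thesis using independent_bound by blast
  qed
  have "P {}" by (simp add: P_def)
  then obtain B where B: "P B" and max: "\<And>B'. P B' \<Longrightarrow> card B' \<le> card B"
    using ex_has_greatest_nat[of P "{}" card "DIM('a) + 1"] card by fastforce
  have fin: "finite B" using B by (simp add: P_def)
  have "x = (\<Sum>b\<in>B. (L x \<bullet> b) *\<^sub>R b)" for x
  proof (rule ccontr)
    define y where "y = x - (\<Sum>b\<in>B. (L x \<bullet> b) *\<^sub>R b)"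
    assume "x \<noteq> (\<Sum>b\<in>B. (L x \<bullet> b) *\<^sub>R b)"
    then have "y \<noteq> 0" by (simp add: y_def)
    have orth: "L y \<bullet> c = 0" if "c \<in> B" for c
      using coord[OF B that, of "\<lambda>b. L x \<bullet> b"] assms(1)
      by (simp add: y_def linear_diff inner_diff_left)
    define z where "z = inverse (sqrt (L y \<bullet> y)) *\<^sub>R y"
    have "L z \<bullet> z = 1"
      using pos[OF \<open>y \<noteq> 0\<close>] assms(1) by (simp add: z_def linear_cmul field_simps)
    moreover have "L z \<bullet> c = 0" if "c \<in> B" for c
      using orth[OF that] assms(1) by (simp add: z_def linear_cmul)
    moreover from this \<open>L z \<bullet> z = 1\<close> have "z \<notin> B" by force
    ultimately have "P (insert z B)"
      using B sym by (auto simp: P_def)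
    from max[OF this] show False using fin \<open>z \<notin> B\<close> by simp
  qed
  then show thesis
    using that[OF fin card[OF B]] B by (simp add: P_def)
qed

text \<open>Computed in a basis orthonormal for an invariant form, the trace is a sum of terms
  \<open>L (A b) \<bullet> b\<close>, each at most 1 because \<open>A\<close> is an isometry of that
  form. Equality forces every basis vector to be fixed.\<close>

lemma lin_trace_power_bounded:
  fixes A :: "'a::euclidean_space \<Rightarrow> 'a"
  assumes "linear A" and "\<And>k x. norm ((A ^^ k) x) \<le> C * norm x"
    and "\<And>k x. norm x \<le> C * norm ((A ^^ k) x)" and "C > 0"
  shows lin_trace_le: "lin_trace A \<le> DIM('a)"
    and lin_trace_eq_imp_id: "lin_trace A = DIM('a) \<Longrightarrow> A x = x"
proof -
  obtain L where L: "linear L" and sym: "\<And>x y. L x \<bullet> y = L y \<bullet> x"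
    and pos: "\<And>x. x \<noteq> 0 \<Longrightarrow> L x \<bullet> x > 0" and inv: "\<And>x y. L (A x) \<bullet> A y = L x \<bullet> y"
    using invariant_form[OF assms] by blast
  obtain B where B: "finite B" "card B \<le> DIM('a)" and unit: "\<And>b. b \<in> B \<Longrightarrow> L b \<bullet> b = 1"
    and rep: "\<And>x. x = (\<Sum>b\<in>B. (L x \<bullet> b) *\<^sub>R b)"
    using orthonormal_basis_form[OF L sym pos] by blast
  \<comment> \<open>Change of basis: \<open>A e\<close> is expanded in the
    \<open>L\<close>-orthonormal set, and summing over \<open>e\<close> then reassembles each
    \<open>b\<close>.\<close>
  have "lin_trace A = (\<Sum>e\<in>Basis. \<Sum>b\<in>B. (L (A e) \<bullet> b) * (b \<bullet> e))"
    unfolding lin_trace_def by (subst rep) (simp add: inner_sum_left)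
  also have "\<dots> = (\<Sum>b\<in>B. \<Sum>e\<in>Basis. (L (A e) \<bullet> b) * (b \<bullet> e))"
    by (rule sum.swap)
  also have "\<dots> = (\<Sum>b\<in>B. L (A b) \<bullet> b)"
  proof (rule sum.cong)
    fix b
    have "L (A b) = L (A (\<Sum>e\<in>Basis. (b \<bullet> e) *\<^sub>R e))" by (simp add: euclidean_representation)
    also have "\<dots> \<bullet> b = (\<Sum>e\<in>Basis. (L (A e) \<bullet> b) * (b \<bullet> e))"
      using L assms(1) by (simp add: linear_sum linear_cmul inner_sum_left mult.commute)
    finally show "(\<Sum>e\<in>Basis. (L (A e) \<bullet> b) * (b \<bullet> e)) = L (A b) \<bullet> b" by simp
  qed simp
  finally have tr: "lin_trace A = (\<Sum>b\<in>B. L (A b) \<bullet> b)" .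
  \<comment> \<open>The squared length of \<open>A b - b\<close> in the invariant form. Its
    nonnegativity gives the bound 1, its vanishing gives \<open>A b = b\<close>.\<close>
  have sq: "L (A b - b) \<bullet> (A b - b) = 2 - 2 * (L (A b) \<bullet> b)" if "b \<in> B" for b
    using L inv[of b b] unit[OF that] sym[of b "A b"]
    by (simp add: linear_diff inner_diff_left inner_diff_right)
  have le1: "L (A b) \<bullet> b \<le> 1" if "b \<in> B" for b
    using sq[OF that] pos[of "A b - b"] L by (cases "A b - b = 0") (auto simp: linear_0)
  have le: "lin_trace A \<le> card B"
    unfolding tr using sum_mono[of B, OF le1] by simp
  then show "lin_trace A \<le> DIM('a)" using B by linarith
  assume "lin_trace A = DIM('a)"
  then have "(\<Sum>b\<in>B. 1 - L (A b) \<bullet> b) \<le> 0" using tr B(2) by (simp add: sum_subtractf)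
  moreover have "(\<Sum>b\<in>B. 1 - L (A b) \<bullet> b) \<ge> 0" by (intro sum_nonneg) (use le1 in auto)
  ultimately have "(\<Sum>b\<in>B. 1 - L (A b) \<bullet> b) = 0" by linarith
  then have "L (A b) \<bullet> b = 1" if "b \<in> B" for b
    using sum_nonneg_eq_0_iff[OF B(1), of "\<lambda>b. 1 - L (A b) \<bullet> b"] le1 that by auto
  then have fixB: "A b = b" if "b \<in> B" for b
    using sq[OF that] that pos[of "A b - b"] by fastforce
  have "A x = A (\<Sum>b\<in>B. (L x \<bullet> b) *\<^sub>R b)" using rep[of x] by simp
  also have "\<dots> = (\<Sum>b\<in>B. (L x \<bullet> b) *\<^sub>R b)"
    using assms(1) fixB by (simp add: linear_sum linear_cmul)
  finally show "A x = x" using rep[of x] by simp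
qed

section \<open>Smooth functions on a Lie group in charts\<close>

text \<open>Generalises \<open>smooth_fun_on\<close> to vector values, so that coordinate maps and
  their compositions with group operations are covered too.\<close>

definition smooth_in ::
  "('a, 'e::real_normed_vector) chart set \<Rightarrow> 'a set \<Rightarrow> ('a \<Rightarrow> 'b::real_normed_vector) \<Rightarrow> bool" where
  "smooth_in A W f \<longleftrightarrow> (\<forall>(U, c)\<in>A. smooth_on (f \<circ> inv_into U c) (c ` (U \<inter> W)))"

lemma smooth_fun_on_iff: "smooth_fun_on A W f \<longleftrightarrow> smooth_in A W f"
  by (simp add: smooth_fun_on_def smooth_in_def)

text \<open>The positive-dimensional case: \<open>open_charts\<close> selects the first alternative
  of \<open>smooth_atlas\<close>, and the chart at the identity serves as coordinates for the Lie
  algebra.\<close>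

locale lie_group_chart = lie_group G A
  for G :: "'a::{t2_space, second_countable_topology} monoid" (structure)
    and A :: "('a, 'e::euclidean_space) chart set" +
  fixes U :: "'a set" and c :: "'a \<Rightarrow> 'e"
  assumes open_charts: "\<And>V d. (V, d) \<in> A \<Longrightarrow> open (d ` V)"
    and chart: "(U, c) \<in> A"
    and one_in_U: "\<one> \<in> U"
begin

definition c_inv :: "'e \<Rightarrow> 'a" where "c_inv = inv_into U c"

definition a :: 'e where "a = c \<one>"

lemma in_carrier [simp]: "x \<in> carrier G" by (simp add: carrier_UNIV)

lemma chart_at: obtains V d where "(V, d) \<in> A" "x \<in> V"
proof -
  have "x \<in> (\<Union>(U, c)\<in>A. U)" using atlas by (simp add: smooth_atlas_def)
  then show thesis using that by auto
qed

lemma chart_homeomorphism: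
  assumes "(V, d) \<in> A"
  shows "open V" "homeomorphism V (d ` V) d (inv_into V d)"
  using atlas assms by (auto simp: smooth_atlas_def)

lemma chart_continuous:
  assumes "(V, d) \<in> A"
  shows "continuous_on V d" "continuous_on (d ` V) (inv_into V d)"
  using chart_homeomorphism[OF assms] by (auto simp: homeomorphism_def)

lemma chart_inv [simp]: "(V, d) \<in> A \<Longrightarrow> x \<in> V \<Longrightarrow> inv_into V d (d x) = x"
  using chart_homeomorphism(2) by (auto simp: homeomorphism_def)

lemma chart_inj: "(V, d) \<in> A \<Longrightarrow> inj_on d V"
  by (rule inj_on_inverseI) (rule chart_inv)

lemma chart_image_open:
  assumes "(V, d) \<in> A" "open W"
  shows "open (d ` (V \<inter> W))"
proof -
  have "openin (top_of_set V) (V \<inter> W)" using assms(2) by blast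
  then have "openin (top_of_set (d ` V)) (d ` (V \<inter> W))"
    using homeomorphism_imp_open_map[OF chart_homeomorphism(2)[OF assms(1)]] by blast
  then show ?thesis using open_charts[OF assms(1)] openin_open_eq by blast
qed

lemma transition:
  assumes "(V, d) \<in> A" "(V', d') \<in> A"
  shows "smooth_on (d \<circ> inv_into V' d') (d' ` (V' \<inter> V))"
  using atlas assms by (auto simp: smooth_atlas_def)

text \<open>Any other chart differs from \<open>d\<close> by a smooth transition map, so a single
  chart around \<open>W\<close> decides smoothness.\<close>

lemma smooth_in_chartI:
  assumes "(V, d) \<in> A" "open W" "W \<subseteq> V" "smooth_on (f \<circ> inv_into V d) (d ` W)"
  shows "smooth_in A W f"
  unfolding smooth_in_def
proof clarify
  fix V' d' assume A: "(V', d') \<in> A"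
  have op: "open (d' ` (V' \<inter> W))" "open (d' ` (V' \<inter> V))" "open (d ` W)"
    using chart_image_open[OF A assms(2)] chart_image_open[OF A chart_homeomorphism(1)[OF assms(1)]]
      chart_image_open[OF assms(1,2)] assms(3) by (auto simp: Int_absorb1)
  have "smooth_on (\<lambda>y. (f \<circ> inv_into V d) ((d \<circ> inv_into V' d') y)) (d' ` (V' \<inter> W))"
  proof (rule smooth_on_compose[OF op(1,3) _ assms(4)])
    show "(d \<circ> inv_into V' d') ` d' ` (V' \<inter> W) \<subseteq> d ` W" using A by auto
    show "smooth_on (d \<circ> inv_into V' d') (d' ` (V' \<inter> W))"
      by (rule smooth_on_subset[OF transition[OF assms(1) A] op(2,1)]) (use assms(3) in auto)
  qed
  then show "smooth_on (f \<circ> inv_into V' d') (d' ` (V' \<inter> W))"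
    by (rule smooth_on_cong[THEN iffD1, rotated]) (use assms(1,3) A in auto)
qed

lemma smooth_in_subset:
  assumes "smooth_in A W f" "open W" "open W'" "W' \<subseteq> W"
  shows "smooth_in A W' f"
  unfolding smooth_in_def
proof clarify
  fix V d assume A: "(V, d) \<in> A"
  then have "smooth_on (f \<circ> inv_into V d) (d ` (V \<inter> W))"
    using assms(1) by (auto simp: smooth_in_def)
  then show "smooth_on (f \<circ> inv_into V d) (d ` (V \<inter> W'))"
    by (rule smooth_on_subset) (use assms chart_image_open[OF A] in auto)
qed

lemma smooth_in_chart_map:
  assumes "(V, d) \<in> A"
  shows "smooth_in A V d"
  using transition[OF assms] by (auto simp: smooth_in_def)

lemma smooth_in_const: "open W \<Longrightarrow> smooth_in A W (\<lambda>x. k)"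
  unfolding smooth_in_def o_def by (auto intro!: smooth_on_const chart_image_open)

lemma smooth_in_cong:
  assumes "\<And>x. x \<in> W \<Longrightarrow> f x = g x"
  shows "smooth_in A W f \<longleftrightarrow> smooth_in A W g"
proof -
  have "smooth_on (f \<circ> inv_into V d) (d ` (V \<inter> W)) \<longleftrightarrow> smooth_on (g \<circ> inv_into V d) (d ` (V \<inter> W))"
    if "(V, d) \<in> A" for V d
    by (rule smooth_on_cong) (use that assms in auto)
  then show ?thesis unfolding smooth_in_def by blast
qed

text \<open>Near a point \<open>x\<close>, the composition factors through a chart at
  \<open>F x\<close>. The resulting local statements are glued by
  \<open>smooth_on_local\<close>.\<close>

lemma smooth_in_compose_map:
  assumes F: "smooth_map A A F" and f: "smooth_in A W f" and "open W"
  shows "smooth_in A (F -` W) (\<lambda>x. f (F x))"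
  unfolding smooth_in_def
proof clarify
  fix V d assume A: "(V, d) \<in> A"
  have opF: "open (F -` S)" if "open S" for S
    using F that by (simp add: smooth_map_def open_vimage)
  show "smooth_on ((\<lambda>x. f (F x)) \<circ> inv_into V d) (d ` (V \<inter> F -` W))"
  proof (rule smooth_on_local[OF chart_image_open[OF A opF[OF \<open>open W\<close>]]])
    fix y assume "y \<in> d ` (V \<inter> F -` W)"
    then obtain x where x: "x \<in> V" "F x \<in> W" "y = d x" by auto
    obtain V' d' where A': "(V', d') \<in> A" "F x \<in> V'" using chart_at .
    let ?S = "d ` (V \<inter> F -` (V' \<inter> W))"
    have op: "open ?S" "open (d' ` (V' \<inter> W))" "open (d ` (V \<inter> F -` V'))"
      using chart_image_open A A'(1) opF \<open>open W\<close> chart_homeomorphism(1)[OF A'(1)]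
      by (auto intro!: chart_image_open opF)
    have "smooth_on (d' \<circ> F \<circ> inv_into V d) (d ` (V \<inter> F -` V'))"
      using F A A'(1) unfolding smooth_map_def by blast
    then have 1: "smooth_on (d' \<circ> F \<circ> inv_into V d) ?S"
      by (rule smooth_on_subset[OF _ op(3,1)]) auto
    have 2: "smooth_on (f \<circ> inv_into V' d') (d' ` (V' \<inter> W))"
      using f A'(1) by (auto simp: smooth_in_def)
    have "smooth_on (\<lambda>y. (f \<circ> inv_into V' d') ((d' \<circ> F \<circ> inv_into V d) y)) ?S"
      by (rule smooth_on_compose[OF op(1,2) _ 2 1]) (use A in auto)
    then have "smooth_on ((\<lambda>x. f (F x)) \<circ> inv_into V d) ?S"
      by (rule smooth_on_cong[THEN iffD1, rotated]) (use A A' in auto)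
    then show "\<exists>T. open T \<and> y \<in> T \<and> smooth_on ((\<lambda>x. f (F x)) \<circ> inv_into V d) T"
      using op(1) x A'(2) by blast
  qed
qed

section \<open>Multiplication and translations in coordinates\<close>

lemma continuous_mult: "continuous_on UNIV (\<lambda>(x, y). x \<otimes> y)"
  using smooth_mult by (simp add: smooth_map_def)

text \<open>The domain, in a pair of charts, of \<open>f\<close> composed with multiplication for a
  function \<open>f\<close> on \<open>W\<close>. It spells out the product coordinates that
  \<open>prod_atlas\<close> offers only through an inverse of \<open>map_prod d d'\<close>.\<close>

definition mult_dom :: "'a set \<Rightarrow> 'a set \<Rightarrow> ('a \<Rightarrow> 'e) \<Rightarrow> 'a set \<Rightarrow> ('a \<Rightarrow> 'e) \<Rightarrow> ('e \<times> 'e) set" where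
  "mult_dom W V d V' d' =
     {(y, x) \<in> d ` V \<times> d' ` V'. inv_into V d y \<otimes> inv_into V' d' x \<in> W}"

lemma open_mult_dom:
  assumes "(V, d) \<in> A" "(V', d') \<in> A" "open W"
  shows "open (mult_dom W V d V' d')"
proof -
  have "continuous_on (d ` V \<times> d' ` V') (\<lambda>z. (inv_into V d (fst z), inv_into V' d' (snd z)))"
    by (intro continuous_intros continuous_on_compose2[OF chart_continuous(2)[OF assms(1)]]
          continuous_on_compose2[OF chart_continuous(2)[OF assms(2)]]) auto
  from continuous_on_compose2[OF continuous_mult this]
  have "continuous_on (d ` V \<times> d' ` V') (\<lambda>z. inv_into V d (fst z) \<otimes> inv_into V' d' (snd z))" by auto
  from continuous_open_preimage[OF this _ assms(3)]
  have "open (d ` V \<times> d' ` V' \<inter> (\<lambda>z. inv_into V d (fst z) \<otimes> inv_into V' d' (snd z)) -` W)"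
    using open_charts assms open_Times by blast
  then show ?thesis
    by (rule arg_cong[where f="open", THEN iffD1, rotated]) (auto simp: mult_dom_def)
qed

text \<open>Smoothness of multiplication is given only in charts of the product atlas with a chart
  around the product as target. Factoring \<open>f\<close> locally through such a chart gives joint
  smoothness of \<open>f (y x)\<close> in both coordinates.\<close>

lemma smooth_mult_chart:
  assumes f: "smooth_in A W f" and "open W" and A: "(V, d) \<in> A" "(V', d') \<in> A"
  shows "smooth_on (\<lambda>(y, x). f (inv_into V d y \<otimes> inv_into V' d' x)) (mult_dom W V d V' d')"
proof (rule smooth_on_local[OF open_mult_dom[OF A \<open>open W\<close>]])
  fix z assume "z \<in> mult_dom W V d V' d'"
  then obtain y x where z: "z = (d y, d' x)" "y \<in> V" "x \<in> V'" "y \<otimes> x \<in> W"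
    using A by (auto simp: mult_dom_def)
  obtain V3 d3 where A3: "(V3, d3) \<in> A" "y \<otimes> x \<in> V3" using chart_at .
  have opV3: "open V3" using chart_homeomorphism(1)[OF A3(1)] .
  let ?m = "\<lambda>(x, y). x \<otimes> y"
  let ?S = "mult_dom (W \<inter> V3) V d V' d'"
  have op: "open ?S" "open (d3 ` (V3 \<inter> W))" "open (mult_dom V3 V d V' d')"
    using open_mult_dom[OF A] chart_image_open[OF A3(1)] opV3 \<open>open W\<close> by auto
  \<comment> \<open>The chosen inverse of the product chart is the pair of inverses, because
    \<open>map_prod d d'\<close> is injective on the product of the domains.\<close>
  have inv: "inv_into (V \<times> V') (map_prod d d') (d y, d' x) = (y, x)" if "y \<in> V" "x \<in> V'" for y x
  proof -
    have "inj_on (map_prod d d') (V \<times> V')"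
      using A by (intro map_prod_inj_on chart_inj)
    from inv_into_f_f[OF this, of "(y, x)"] that show ?thesis by simp
  qed
  have "(V \<times> V', map_prod d d') \<in> prod_atlas A A" using A by (auto simp: prod_atlas_def)
  then have "smooth_on (d3 \<circ> ?m \<circ> inv_into (V \<times> V') (map_prod d d'))
               (map_prod d d' ` ((V \<times> V') \<inter> ?m -` V3))"
    using smooth_mult A3(1) unfolding smooth_map_def by blast
  also have "map_prod d d' ` ((V \<times> V') \<inter> ?m -` V3) = mult_dom V3 V d V' d'"
  proof (intro equalityI subsetI)
    fix z assume "z \<in> mult_dom V3 V d V' d'"
    then obtain y x where "z = map_prod d d' (y, x)" "y \<in> V" "x \<in> V'" "y \<otimes> x \<in> V3"
      using A by (auto simp: mult_dom_def)
    then show "z \<in> map_prod d d' ` ((V \<times> V') \<inter> ?m -` V3)" by (intro image_eqI) auto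
  qed (use A in \<open>auto simp: mult_dom_def\<close>)
  finally have 1: "smooth_on (d3 \<circ> ?m \<circ> inv_into (V \<times> V') (map_prod d d')) ?S"
    by (rule smooth_on_subset[OF _ op(3,1)]) (auto simp: mult_dom_def)
  have 2: "smooth_on (f \<circ> inv_into V3 d3) (d3 ` (V3 \<inter> W))"
    using f A3(1) by (auto simp: smooth_in_def)
  have "smooth_on (\<lambda>z. (f \<circ> inv_into V3 d3) ((d3 \<circ> ?m \<circ> inv_into (V \<times> V') (map_prod d d')) z)) ?S"
    by (rule smooth_on_compose[OF op(1,2) _ 2 1]) (use A in \<open>auto simp: mult_dom_def inv\<close>)
  then have "smooth_on (\<lambda>(y, x). f (inv_into V d y \<otimes> inv_into V' d' x)) ?S"
    by (rule smooth_on_cong[THEN iffD1, rotated]) (use A A3 in \<open>auto simp: mult_dom_def inv\<close>)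
  then show "\<exists>T. open T \<and> z \<in> T \<and>
      smooth_on (\<lambda>(y, x). f (inv_into V d y \<otimes> inv_into V' d' x)) T"
    using op(1) z A A3 by (intro exI[of _ ?S]) (auto simp: mult_dom_def)
qed

lemma continuous_lmult: "continuous_on S (\<lambda>x. g \<otimes> x)"
  using continuous_on_compose2[OF continuous_mult continuous_on_Pair[OF continuous_on_const continuous_on_id]] by simp

lemma continuous_rmult: "continuous_on S (\<lambda>x. x \<otimes> g)"
  using continuous_on_compose2[OF continuous_mult continuous_on_Pair[OF continuous_on_id continuous_on_const]] by simp

text \<open>The first coordinate of the jointly smooth map \<open>f (y x)\<close> is frozen at the
  coordinate of \<open>g\<close>.\<close>

lemma smooth_in_lmult:
  assumes f: "smooth_in A W f" and "open W"
  shows "smooth_in A ((\<lambda>x. g \<otimes> x) -` W) (\<lambda>x. f (g \<otimes> x))"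
  unfolding smooth_in_def
proof clarify
  fix V d assume A: "(V, d) \<in> A"
  obtain V' d' where A': "(V', d') \<in> A" "g \<in> V'" using chart_at .
  have op: "open ((\<lambda>x. g \<otimes> x) -` W)" using continuous_lmult[of UNIV] \<open>open W\<close> by (simp add: open_vimage)
  have opS: "open (d ` (V \<inter> (\<lambda>x. g \<otimes> x) -` W))" by (rule chart_image_open[OF A op])
  have 1: "smooth_on (\<lambda>x. (d' g, x)) (d ` (V \<inter> (\<lambda>x. g \<otimes> x) -` W))"
    by (intro smooth_on_Pair smooth_on_const smooth_on_linear[OF bounded_linear_ident] opS)
  have "smooth_on (\<lambda>x. (\<lambda>(y, x). f (inv_into V' d' y \<otimes> inv_into V d x)) (d' g, x))
          (d ` (V \<inter> (\<lambda>x. g \<otimes> x) -` W))"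
    by (rule smooth_on_compose[OF opS open_mult_dom[OF A'(1) A \<open>open W\<close>] _ smooth_mult_chart[OF f \<open>open W\<close> A'(1) A] 1])
       (use A A' in \<open>auto simp: mult_dom_def\<close>)
  then show "smooth_on ((\<lambda>x. f (g \<otimes> x)) \<circ> inv_into V d) (d ` (V \<inter> (\<lambda>x. g \<otimes> x) -` W))"
    by (rule smooth_on_cong[THEN iffD1, rotated]) (use A A' in auto)
qed

lemma smooth_in_rmult:
  assumes f: "smooth_in A W f" and "open W"
  shows "smooth_in A ((\<lambda>x. x \<otimes> g) -` W) (\<lambda>x. f (x \<otimes> g))"
  unfolding smooth_in_def
proof clarify
  fix V d assume A: "(V, d) \<in> A"
  obtain V' d' where A': "(V', d') \<in> A" "g \<in> V'" using chart_at .
  have op: "open ((\<lambda>x. x \<otimes> g) -` W)" using continuous_rmult[of UNIV] \<open>open W\<close> by (simp add: open_vimage)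
  have opS: "open (d ` (V \<inter> (\<lambda>x. x \<otimes> g) -` W))" by (rule chart_image_open[OF A op])
  have 1: "smooth_on (\<lambda>x. (x, d' g)) (d ` (V \<inter> (\<lambda>x. x \<otimes> g) -` W))"
    by (intro smooth_on_Pair smooth_on_const smooth_on_linear[OF bounded_linear_ident] opS)
  have "smooth_on (\<lambda>x. (\<lambda>(y, x). f (inv_into V d y \<otimes> inv_into V' d' x)) (x, d' g))
          (d ` (V \<inter> (\<lambda>x. x \<otimes> g) -` W))"
    by (rule smooth_on_compose[OF opS open_mult_dom[OF A A'(1) \<open>open W\<close>] _ smooth_mult_chart[OF f \<open>open W\<close> A A'(1)] 1])
       (use A A' in \<open>auto simp: mult_dom_def\<close>)
  then show "smooth_on ((\<lambda>x. f (x \<otimes> g)) \<circ> inv_into V d) (d ` (V \<inter> (\<lambda>x. x \<otimes> g) -` W))"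
    by (rule smooth_on_cong[THEN iffD1, rotated]) (use A A' in auto)
qed

end

section \<open>Left-invariant vector fields\<close>

lemma has_derivative_slice_snd:
  assumes "(F has_derivative F') (at (y, x))"
  shows "((\<lambda>x. F (y, x)) has_derivative (\<lambda>v. F' (0, v))) (at x)"
proof -
  have "((\<lambda>x. (y, x)) has_derivative (\<lambda>v. (0, v))) (at x)"
    by (intro has_derivative_Pair has_derivative_const has_derivative_ident)
  from diff_chain_at[OF this assms] show ?thesis by (simp add: o_def)
qed

lemma has_derivative_slice_fst:
  assumes "(F has_derivative F') (at (y, x))"
  shows "((\<lambda>y. F (y, x)) has_derivative (\<lambda>v. F' (v, 0))) (at y)"
proof -
  have "((\<lambda>y. (y, x)) has_derivative (\<lambda>v. (v, 0))) (at y)"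
    by (intro has_derivative_Pair has_derivative_const has_derivative_ident)
  from diff_chain_at[OF this assms] show ?thesis by (simp add: o_def)
qed

context lie_group_chart
begin

lemma a_in: "a \<in> c ` U" and c_inv_a [simp]: "c_inv a = \<one>"
  using chart one_in_U by (auto simp: a_def c_inv_def)

section \<open>Germs of smooth functions\<close>

lemma smooth_in_add:
  assumes "smooth_in A W f" "smooth_in A W g" "open W"
  shows "smooth_in A W (\<lambda>x. f x + g x)"
  unfolding smooth_in_def o_def
proof clarify
  fix V d assume A: "(V, d) \<in> A"
  with assms(1,2) have "smooth_on (\<lambda>x. f (inv_into V d x)) (d ` (V \<inter> W))"
    "smooth_on (\<lambda>x. g (inv_into V d x)) (d ` (V \<inter> W))"
    unfolding smooth_in_def o_def by auto
  then show "smooth_on (\<lambda>x. f (inv_into V d x) + g (inv_into V d x)) (d ` (V \<inter> W))"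
    by (rule smooth_on_add[OF chart_image_open[OF A assms(3)]])
qed

lemma smooth_in_mult:
  fixes f g :: "'a \<Rightarrow> real"
  assumes "smooth_in A W f" "smooth_in A W g" "open W"
  shows "smooth_in A W (\<lambda>x. f x * g x)"
  unfolding smooth_in_def o_def
proof clarify
  fix V d assume A: "(V, d) \<in> A"
  with assms(1,2) have "smooth_on (\<lambda>x. f (inv_into V d x)) (d ` (V \<inter> W))"
    "smooth_on (\<lambda>x. g (inv_into V d x)) (d ` (V \<inter> W))"
    unfolding smooth_in_def o_def by auto
  from smooth_on_scaleR[OF chart_image_open[OF A assms(3)] this]
  show "smooth_on (\<lambda>x. f (inv_into V d x) * g (inv_into V d x)) (d ` (V \<inter> W))"
    by simp
qed

lemma smooth_in_linear_compose:
  assumes "smooth_in A W f" "bounded_linear h" "open W"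
  shows "smooth_in A W (\<lambda>x. h (f x))"
  unfolding smooth_in_def o_def
proof clarify
  fix V d assume A: "(V, d) \<in> A"
  with assms(1) have "smooth_on (\<lambda>x. f (inv_into V d x)) (d ` (V \<inter> W))"
    unfolding smooth_in_def o_def by auto
  then show "smooth_on (\<lambda>x. h (f (inv_into V d x))) (d ` (V \<inter> W))"
    by (rule smooth_on_linear_compose[OF assms(2) chart_image_open[OF A assms(3)]])
qed

lemma smooth_fun_at_iff:
  "smooth_fun_at A p f \<longleftrightarrow> (\<exists>W. open W \<and> p \<in> W \<and> smooth_in A W f)"
  by (simp add: smooth_fun_at_def smooth_fun_on_iff)

lemma smooth_fun_at_const: "smooth_fun_at A p (\<lambda>x. k)"
  unfolding smooth_fun_at_iff using smooth_in_const[of UNIV] by blast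

lemma smooth_fun_at_binary:
  assumes "smooth_fun_at A p f" "smooth_fun_at A p g"
    and "\<And>W. open W \<Longrightarrow> smooth_in A W f \<Longrightarrow> smooth_in A W g \<Longrightarrow> smooth_in A W h"
  shows "smooth_fun_at A p h"
proof -
  obtain W W' where W: "open W" "p \<in> W" "smooth_in A W f" "open W'" "p \<in> W'" "smooth_in A W' g"
    using assms(1,2) unfolding smooth_fun_at_iff by blast
  then have "smooth_in A (W \<inter> W') f" "smooth_in A (W \<inter> W') g"
    using smooth_in_subset open_Int by (metis inf_le1, metis inf_le2 open_Int smooth_in_subset)
  with assms(3)[of "W \<inter> W'"] W show ?thesis unfolding smooth_fun_at_iff by blast
qed

lemma smooth_fun_at_add:
  "smooth_fun_at A p f \<Longrightarrow> smooth_fun_at A p g \<Longrightarrow> smooth_fun_at A p (\<lambda>x. f x + g x)"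
  by (erule (1) smooth_fun_at_binary) (rule smooth_in_add)

lemma smooth_fun_at_mult:
  "smooth_fun_at A p f \<Longrightarrow> smooth_fun_at A p g \<Longrightarrow> smooth_fun_at A p (\<lambda>x. f x * g x)"
  by (erule (1) smooth_fun_at_binary) (rule smooth_in_mult)

lemma smooth_fun_at_sum:
  assumes "\<And>i. i \<in> I \<Longrightarrow> smooth_fun_at A p (f i)"
  shows "smooth_fun_at A p (\<lambda>x. \<Sum>i\<in>I. f i x)"
  using assms
  by (induction I rule: infinite_finite_induct) (auto intro: smooth_fun_at_const smooth_fun_at_add)

lemma smooth_fun_at_cong:
  assumes "open W" "p \<in> W" "\<And>x. x \<in> W \<Longrightarrow> f x = g x" "smooth_fun_at A p f"
  shows "smooth_fun_at A p g"
proof -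
  obtain W' where W': "open W'" "p \<in> W'" "smooth_in A W' f"
    using assms(4) by (auto simp: smooth_fun_at_iff)
  have "smooth_in A (W \<inter> W') f"
    by (rule smooth_in_subset[OF W'(3,1)]) (use assms W' in auto)
  then have "smooth_in A (W \<inter> W') g"
    by (rule smooth_in_cong[THEN iffD1, rotated]) (use assms in auto)
  then show ?thesis unfolding smooth_fun_at_iff using assms W' by blast
qed

lemma smooth_fun_at_coordinate: "smooth_fun_at A \<one> (\<lambda>x. c x \<bullet> b)"
proof -
  have "smooth_in A U (\<lambda>x. c x \<bullet> b)"
    by (rule smooth_in_linear_compose[OF smooth_in_chart_map[OF chart] bounded_linear_inner_left
          chart_homeomorphism(1)[OF chart]])
  then show ?thesis
    unfolding smooth_fun_at_iff using chart_homeomorphism(1)[OF chart] one_in_U by blast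
qed

lemma smooth_fun_at_translate:
  "smooth_fun_at A (g \<otimes> x) f \<longleftrightarrow> smooth_fun_at A x (\<lambda>y. f (g \<otimes> y))"
proof -
  have imp: "smooth_fun_at A x (\<lambda>y. f (g \<otimes> y))" if f: "smooth_fun_at A (g \<otimes> x) f" for g x f
  proof -
    obtain W where W: "open W" "g \<otimes> x \<in> W" "smooth_in A W f"
      using f unfolding smooth_fun_at_iff by blast
    have "open ((\<lambda>x. g \<otimes> x) -` W)"
      using continuous_lmult[of UNIV] W(1) by (simp add: open_vimage)
    with smooth_in_lmult[OF W(3,1), of g] W(2) show ?thesis
      unfolding smooth_fun_at_iff by blast
  qed
  \<comment> \<open>The converse is the same implication for translation by
    \<open>inv g\<close>.\<close>
  have "smooth_fun_at A (g \<otimes> x) f" if "smooth_fun_at A x (\<lambda>y. f (g \<otimes> y))"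
    using imp[of "inv g" "g \<otimes> x" "\<lambda>y. f (g \<otimes> y)"] that by (simp flip: m_assoc)
  then show ?thesis using imp by blast
qed

section \<open>Left-invariant fields with prescribed value at the identity\<close>

lemma smooth_in_chart_one:
  assumes "smooth_in A W h" "open W" "\<one> \<in> W"
  shows "smooth_on (\<lambda>x. h (c_inv x)) (c ` (U \<inter> W))" "open (c ` (U \<inter> W))" "a \<in> c ` (U \<inter> W)"
  using assms chart one_in_U chart_image_open[OF chart assms(2)]
  by (auto simp: smooth_in_def o_def c_inv_def a_def)

lemma smooth_fun_at_has_derivative:
  assumes "smooth_fun_at A p f"
  shows "((\<lambda>x. f (p \<otimes> c_inv x)) has_derivative frechet_derivative (\<lambda>x. f (p \<otimes> c_inv x)) (at a)) (at a)"
proof -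
  have "smooth_fun_at A \<one> (\<lambda>y. f (p \<otimes> y))"
    using assms smooth_fun_at_translate[of p \<one> f] by simp
  then obtain W where W: "smooth_in A W (\<lambda>y. f (p \<otimes> y))" "open W" "\<one> \<in> W"
    unfolding smooth_fun_at_iff by blast
  from smooth_on_has_derivative[OF smooth_in_chart_one[OF W]] show ?thesis .
qed

text \<open>The left-invariant field whose value at the identity has chart coordinates
  \<open>v\<close>: the chart is carried to \<open>p\<close> by left translation. The value 0 on
  other functions follows the convention of \<open>tangent_space\<close>.\<close>

definition left_vfield :: "'e \<Rightarrow> 'a vfield" where
  "left_vfield v p f = (if smooth_fun_at A p f then frechet_derivative (\<lambda>x. f (p \<otimes> c_inv x)) (at a) v else 0)"

lemma left_vfield_tangent: "left_vfield v p \<in> tangent_space A p"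
proof -
  have "left_vfield v p (\<lambda>x. s * f x + t * g x) = s * left_vfield v p f + t * left_vfield v p g"
    if f: "smooth_fun_at A p f" and g: "smooth_fun_at A p g" for f g s t
  proof -
    have "smooth_fun_at A p (\<lambda>x. s * f x + t * g x)"
      by (intro smooth_fun_at_add smooth_fun_at_mult smooth_fun_at_const f g)
    moreover note frechet_derivative_at[OF has_derivative_add[OF
      has_derivative_mult_right[OF smooth_fun_at_has_derivative[OF f], of s]
      has_derivative_mult_right[OF smooth_fun_at_has_derivative[OF g], of t]], symmetric]
    ultimately show ?thesis using f g by (simp add: left_vfield_def)
  qed
  moreover have "left_vfield v p (\<lambda>x. f x * g x) = f p * left_vfield v p g + left_vfield v p f * g p"
    if f: "smooth_fun_at A p f" and g: "smooth_fun_at A p g" for f g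
  proof -
    have "smooth_fun_at A p (\<lambda>x. f x * g x)"
      by (intro smooth_fun_at_mult f g)
    moreover note frechet_derivative_at[OF has_derivative_mult[OF
      smooth_fun_at_has_derivative[OF f] smooth_fun_at_has_derivative[OF g]], symmetric]
    ultimately show ?thesis using f g by (simp add: left_vfield_def)
  qed
  ultimately show ?thesis by (simp add: tangent_space_def left_vfield_def)
qed

text \<open>In charts, the derivative in question is a partial derivative in \<open>x\<close>, taken
  at \<open>x = a\<close>, of the jointly smooth map \<open>f (y x)\<close>; it therefore depends
  smoothly on \<open>y\<close>.\<close>

lemma left_vfield_smooth:
  assumes "open W" "smooth_in A W f"
  shows "smooth_in A W (\<lambda>p. left_vfield v p f)"
  unfolding smooth_in_def
proof clarify
  fix V d assume A: "(V, d) \<in> A"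
  let ?F = "\<lambda>(y, x). f (inv_into V d y \<otimes> inv_into U c x)"
  let ?S = "mult_dom W V d U c"
  let ?G = "\<lambda>z. frechet_derivative ?F (at z) (0, v)"
  note opS = open_mult_dom[OF A chart assms(1)] and opV = chart_image_open[OF A assms(1)]
  note F = smooth_mult_chart[OF assms(2,1) A chart]
  have mem: "(y, a) \<in> ?S" if "y \<in> d ` (V \<inter> W)" for y
    using that A a_in c_inv_a by (auto simp: mult_dom_def c_inv_def)
  have "smooth_on (\<lambda>y. ?G (y, a)) (d ` (V \<inter> W))"
    by (rule smooth_on_compose[OF opV opS _ smooth_on_derivative[OF F opS]
          smooth_on_Pair[OF opV smooth_on_linear[OF bounded_linear_ident opV] smooth_on_const[OF opV]]])
       (use mem in auto)
  moreover have "?G (y, a) = ((\<lambda>p. left_vfield v p f) \<circ> inv_into V d) y" if y: "y \<in> d ` (V \<inter> W)" for y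
  proof -
    have "((\<lambda>x. ?F (y, x)) has_derivative (\<lambda>v. frechet_derivative ?F (at (y, a)) (0, v))) (at a)"
      by (intro has_derivative_slice_snd smooth_on_has_derivative[OF F opS] mem y)
    from frechet_derivative_at[OF this]
    have "?G (y, a) = frechet_derivative (\<lambda>x. f (inv_into V d y \<otimes> c_inv x)) (at a) v"
      by (simp add: c_inv_def fun_eq_iff)
    moreover have "smooth_fun_at A (inv_into V d y) f"
      using y A assms by (auto simp: smooth_fun_at_iff)
    ultimately show ?thesis by (simp add: left_vfield_def)
  qed
  ultimately show "smooth_on ((\<lambda>p. left_vfield v p f) \<circ> inv_into V d) (d ` (V \<inter> W))"
    by (rule smooth_on_cong[THEN iffD1, rotated])
qed

lemma left_vfield_translate: "left_vfield v (g \<otimes> h) f = left_vfield v h (\<lambda>x. f (g \<otimes> x))"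
  by (simp add: left_vfield_def smooth_fun_at_translate m_assoc)

lemma left_vfield_in_lie_algebra: "left_vfield v \<in> lie_algebra G A"
  using left_vfield_tangent left_vfield_smooth left_vfield_translate
  by (simp add: lie_algebra_def smooth_vector_fields_def smooth_fun_on_iff)

lemma left_vfield_nonzero:
  assumes "v \<noteq> 0"
  shows "left_vfield v \<noteq> zero_vfield"
proof
  assume eq: "left_vfield v = zero_vfield"
  \<comment> \<open>A test function that is linear in the chart; the field takes the value
    \<open>v \<bullet> v\<close> on it at the identity.\<close>
  let ?f = "\<lambda>x. c x \<bullet> v"
  have "((\<lambda>x. x \<bullet> v) has_derivative (\<lambda>x. x \<bullet> v)) (at a)"
    by (rule bounded_linear_imp_has_derivative[OF bounded_linear_inner_left])
  then have "((\<lambda>x. ?f (\<one> \<otimes> c_inv x)) has_derivative (\<lambda>x. x \<bullet> v)) (at a)"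
    by (rule has_derivative_transform_within_open[OF _ open_charts[OF chart] a_in])
       (use chart in \<open>auto simp: c_inv_def\<close>)
  from fun_cong[OF frechet_derivative_at[OF this], of v] have "left_vfield v \<one> ?f = v \<bullet> v"
    by (simp add: left_vfield_def smooth_fun_at_coordinate)
  with eq assms show False by (simp add: zero_vfield_def)
qed

section \<open>Derivations at the identity are directional derivatives\<close>

context
  fixes D
  assumes D: "D \<in> tangent_space A \<one>"
begin

lemma derivation_lin:
  "smooth_fun_at A \<one> f \<Longrightarrow> smooth_fun_at A \<one> g \<Longrightarrow> D (\<lambda>x. s * f x + t * g x) = s * D f + t * D g"
  using D by (simp add: tangent_space_def)

lemma derivation_mult:
  "smooth_fun_at A \<one> f \<Longrightarrow> smooth_fun_at A \<one> g \<Longrightarrow> D (\<lambda>x. f x * g x) = f \<one> * D g + D f * g \<one>"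
  using D by (simp add: tangent_space_def)

lemma derivation_add:
  "smooth_fun_at A \<one> f \<Longrightarrow> smooth_fun_at A \<one> g \<Longrightarrow> D (\<lambda>x. f x + g x) = D f + D g"
  using derivation_lin[of f g 1 1] by simp

lemma derivation_const: "D (\<lambda>x. k) = 0"
proof -
  \<comment> \<open>The product rule for \<open>1 = 1 * 1\<close> gives twice the value on the
    right.\<close>
  have "D (\<lambda>x. 1) = 0" using derivation_mult[OF smooth_fun_at_const smooth_fun_at_const, of 1 1] by simp
  then show ?thesis using derivation_lin[OF smooth_fun_at_const smooth_fun_at_const, of k 1 0 1] by simp
qed

lemma derivation_sum:
  assumes "\<And>i. i \<in> I \<Longrightarrow> smooth_fun_at A \<one> (f i)"
  shows "D (\<lambda>x. \<Sum>i\<in>I. f i x) = (\<Sum>i\<in>I. D (f i))"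
  using assms
  by (induction I rule: infinite_finite_induct)
     (auto simp: derivation_const derivation_add smooth_fun_at_sum)

text \<open>Derivations act on functions, not on germs. The difference \<open>f - g\<close> equals
  its own product with the indicator of the complement of \<open>W\<close>; both factors vanish at
  the identity, so the product rule gives zero.\<close>

lemma derivation_local:
  assumes W: "open W" "\<one> \<in> W" and eq: "\<And>x. x \<in> W \<Longrightarrow> f x = g x" and f: "smooth_fun_at A \<one> f"
  shows "D f = D g"
proof -
  have g: "smooth_fun_at A \<one> g" by (rule smooth_fun_at_cong[OF W eq f])
  let ?k = "\<lambda>x. 1 * f x + (-1) * g x" and ?i = "\<lambda>x. if x \<in> W then 0 else (1::real)"
  have k: "smooth_fun_at A \<one> ?k"
    by (intro smooth_fun_at_add smooth_fun_at_mult smooth_fun_at_const f g)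
  have i: "smooth_fun_at A \<one> ?i"
    by (rule smooth_fun_at_cong[OF W _ smooth_fun_at_const[of _ 0]]) simp
  have "?k = (\<lambda>x. ?k x * ?i x)" using eq by auto
  then have "D ?k = D (\<lambda>x. ?k x * ?i x)" by (rule arg_cong)
  also have "\<dots> = 0" using derivation_mult[OF k i] W(2) eq[OF W(2)] by simp
  finally show ?thesis using derivation_lin[OF f g, of 1 "-1"] by simp
qed

text \<open>Near the identity, Hadamard's lemma writes \<open>h\<close> as a constant plus products
  of centred coordinates with smooth functions, so the values of \<open>D\<close> on the coordinates
  determine it.\<close>

lemma derivation_directional:
  assumes h: "smooth_fun_at A \<one> h"
  shows "D h = frechet_derivative (\<lambda>x. h (c_inv x)) (at a) (\<Sum>b\<in>Basis. D (\<lambda>x. c x \<bullet> b) *\<^sub>R b)"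
proof -
  obtain W where W: "smooth_in A W h" "open W" "\<one> \<in> W"
    using h unfolding smooth_fun_at_iff by blast
  note chart_one = smooth_in_chart_one[OF W]
  obtain r where r: "r > 0" "ball a r \<subseteq> c ` (U \<inter> W)" using chart_one(2,3) openE by blast
  have sm: "smooth_on (\<lambda>x. h (c_inv x)) (ball a r)"
    by (rule smooth_on_subset[OF chart_one(1,2) open_ball r(2)])
  obtain g where g: "\<And>b. smooth_on (g b) (ball a r)"
    and ga: "\<And>b. g b a = frechet_derivative (\<lambda>x. h (c_inv x)) (at a) b"
    and taylor: "\<And>x. x \<in> ball a r \<Longrightarrow>
      h (c_inv x) = h (c_inv a) + (\<Sum>b\<in>Basis. ((x - a) \<bullet> b) * g b x)"
    using hadamard_smooth[OF sm r(1)] by blast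
  \<comment> \<open>The part of the chart domain where the expansion is available;
    \<open>derivation_local\<close> discards the rest.\<close>
  define N where "N = U \<inter> c -` ball a r"
  have N: "open N" "\<one> \<in> N"
    using continuous_open_preimage[OF chart_continuous(1)[OF chart] chart_homeomorphism(1)[OF chart] open_ball]
      one_in_U r(1) by (auto simp: N_def a_def)
  have cN: "c ` N = ball a r" using r(2) by (auto simp: N_def)
  have q: "smooth_fun_at A \<one> (\<lambda>x. g b (c x))" for b
  proof -
    have "smooth_on (g b) (c ` N) \<longleftrightarrow> smooth_on ((\<lambda>x. g b (c x)) \<circ> inv_into U c) (c ` N)"
      by (rule smooth_on_cong) (use chart in \<open>auto simp: N_def\<close>)
    with g[of b] cN have "smooth_on ((\<lambda>x. g b (c x)) \<circ> inv_into U c) (c ` N)" by simp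
    then have "smooth_in A N (\<lambda>x. g b (c x))"
      by (intro smooth_in_chartI[OF chart N(1)]) (auto simp: N_def)
    then show ?thesis unfolding smooth_fun_at_iff using N by blast
  qed
  have k_eq: "(\<lambda>x. (c x - a) \<bullet> b) = (\<lambda>x. 1 * (c x \<bullet> b) + (- (a \<bullet> b)) * 1)" for b
    by (auto simp: inner_diff_left)
  have k: "smooth_fun_at A \<one> (\<lambda>x. (c x - a) \<bullet> b)" for b
    unfolding k_eq by (intro smooth_fun_at_add smooth_fun_at_mult smooth_fun_at_const smooth_fun_at_coordinate)
  have Dk: "D (\<lambda>x. (c x - a) \<bullet> b) = D (\<lambda>x. c x \<bullet> b)" for b
    unfolding k_eq by (subst derivation_lin) (auto simp: smooth_fun_at_const smooth_fun_at_coordinate derivation_const)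
  have "D h = D (\<lambda>x. h \<one> + (\<Sum>b\<in>Basis. ((c x - a) \<bullet> b) * g b (c x)))"
  proof (rule derivation_local[OF N _ h])
    fix x assume "x \<in> N"
    then have "c_inv (c x) = x" "c x \<in> ball a r"
      using chart by (auto simp: N_def c_inv_def)
    with taylor[of "c x"] show "h x = h \<one> + (\<Sum>b\<in>Basis. ((c x - a) \<bullet> b) * g b (c x))" by simp
  qed
  also have "\<dots> = (\<Sum>b\<in>Basis. D (\<lambda>x. ((c x - a) \<bullet> b) * g b (c x)))"
    using derivation_sum[OF smooth_fun_at_mult[OF k q]]
    by (subst derivation_add) (auto simp: derivation_const intro!: smooth_fun_at_const smooth_fun_at_sum smooth_fun_at_mult k q)
  \<comment> \<open>The centred coordinates vanish at the identity, so the derivatives of the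
    coefficients drop out of the product rule.\<close>
  also have "\<dots> = (\<Sum>b\<in>Basis. D (\<lambda>x. c x \<bullet> b) * g b a)"
    by (intro sum.cong) (simp_all add: derivation_mult[OF k q] Dk a_def[symmetric])
  also have "\<dots> = frechet_derivative (\<lambda>x. h (c_inv x)) (at a) (\<Sum>b\<in>Basis. D (\<lambda>x. c x \<bullet> b) *\<^sub>R b)"
    using has_derivative_linear[OF smooth_on_has_derivative[OF chart_one]]
    by (simp add: linear_sum linear_cmul ga)
  finally show ?thesis .
qed

end

text \<open>Left invariance reduces the action of \<open>Y\<close> at \<open>p\<close> to its
  derivation at the identity, and \<open>w\<close> lists the values of that derivation on the
  coordinates.\<close>

lemma lie_algebra_left_vfield:
  assumes "Y \<in> lie_algebra G A"
  obtains w where "Y = left_vfield w"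
proof
  let ?w = "\<Sum>b\<in>Basis. Y \<one> (\<lambda>x. c x \<bullet> b) *\<^sub>R b"
  have tan: "\<And>p. Y p \<in> tangent_space A p"
    and inv: "\<And>g h f. smooth_fun_at A (g \<otimes> h) f \<Longrightarrow> Y (g \<otimes> h) f = Y h (\<lambda>x. f (g \<otimes> x))"
    using assms by (auto simp: lie_algebra_def smooth_vector_fields_def)
  show "Y = left_vfield ?w"
  proof (intro ext)
    fix p f
    show "Y p f = left_vfield ?w p f"
    proof (cases "smooth_fun_at A p f")
      case True
      then have "Y p f = Y \<one> (\<lambda>x. f (p \<otimes> x))" using inv[of p \<one> f] by simp
      also have "\<dots> = left_vfield ?w p f"
        using derivation_directional[OF tan, of "\<lambda>x. f (p \<otimes> x)"] True smooth_fun_at_translate[of p \<one> f]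
        by (simp add: left_vfield_def)
      finally show ?thesis .
    next
      case False
      then show ?thesis using tan[of p] by (simp add: tangent_space_def left_vfield_def)
    qed
  qed
qed

end

section \<open>The adjoint representation\<close>

text \<open>Zeros of \<open>f\<close> accumulating at the zero \<open>x\<close> make the difference
  quotients along them vanish, so the derivative vanishes in their limiting direction. This turns
  information on kernel elements near the identity into an equation for \<open>v\<close>.\<close>

lemma has_derivative_zero_along_sequence:
  assumes f: "(f has_derivative f') (at x)" and "f x = 0" and zero: "\<And>n. f (y n) = 0"
    and y: "y \<longlonglongrightarrow> x" "\<And>n. y n \<noteq> x"
    and dir: "(\<lambda>n. inverse (norm (y n - x)) *\<^sub>R (y n - x)) \<longlonglongrightarrow> v"
  shows "f' v = 0"
proof -
  have bl: "bounded_linear f'" and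
    lim: "((\<lambda>z. (f z - f x - f' (z - x)) /\<^sub>R norm (z - x)) \<longlongrightarrow> 0) (at x)"
    using f by (auto simp: has_derivative_at_within)
  have "filterlim y (at x) sequentially"
    using y by (auto simp: filterlim_at)
  from filterlim_compose[OF lim this]
  have "(\<lambda>n. - f' (inverse (norm (y n - x)) *\<^sub>R (y n - x))) \<longlonglongrightarrow> 0"
    using bl zero assms(2) by (simp add: linear_cmul bounded_linear.linear)
  moreover have "(\<lambda>n. - f' (inverse (norm (y n - x)) *\<^sub>R (y n - x))) \<longlonglongrightarrow> - f' v"
    by (intro tendsto_minus bounded_linear.tendsto[OF bl dir])
  ultimately have "- f' v = 0" by (rule LIMSEQ_unique[symmetric])
  then show ?thesis by simp
qed

section \<open>Differentials at the identity of maps that fix it\<close>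

context lie_group_chart
begin

text \<open>Only what the chain rule at the identity needs: smoothness near it into the one chart
  \<open>c\<close>, and continuity to keep nearby images in the chart. Conjugations and
  automorphisms both qualify.\<close>

definition pointed :: "('a \<Rightarrow> 'a) \<Rightarrow> bool" where
  "pointed F \<longleftrightarrow> F \<one> = \<one> \<and> continuous_on UNIV F \<and>
     (\<exists>W. open W \<and> \<one> \<in> W \<and> smooth_in A W (\<lambda>x. c (F x)))"

definition differential :: "('a \<Rightarrow> 'a) \<Rightarrow> 'e \<Rightarrow> 'e" where
  "differential F = frechet_derivative (\<lambda>x. c (F (c_inv x))) (at a)"

lemma pointed_has_derivative:
  assumes "pointed F"
  shows "((\<lambda>x. c (F (c_inv x))) has_derivative differential F) (at a)"
proof -
  obtain W where "smooth_in A W (\<lambda>x. c (F x))" "open W" "\<one> \<in> W"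
    using assms unfolding pointed_def by blast
  from smooth_on_has_derivative[OF smooth_in_chart_one[OF this]]
  show ?thesis by (simp add: differential_def)
qed

lemma linear_differential: "pointed F \<Longrightarrow> linear (differential F)"
  using pointed_has_derivative has_derivative_linear by blast

lemma has_derivative_compose_pointed:
  assumes F: "pointed F" and h: "((\<lambda>x. h (c_inv x)) has_derivative H) (at a)"
  shows "((\<lambda>x. h (F (c_inv x))) has_derivative (\<lambda>v. H (differential F v))) (at a)"
proof -
  have op: "open (F -` U)"
    using F chart_homeomorphism(1)[OF chart] by (auto simp: pointed_def intro: open_vimage)
  have "c (F (c_inv a)) = a" using F by (simp add: pointed_def flip: a_def)
  with h diff_chain_at[OF pointed_has_derivative[OF F], of "\<lambda>x. h (c_inv x)" H]
  have "((\<lambda>x. h (c_inv (c (F (c_inv x))))) has_derivative (\<lambda>v. H (differential F v))) (at a)"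
    by (simp add: o_def)
  \<comment> \<open>Inserting \<open>c_inv\<close> after \<open>c\<close> is legitimate only while
    \<open>F\<close> stays in \<open>U\<close>, which holds near the base point.\<close>
  then show ?thesis
  proof (rule has_derivative_transform_within_open)
    show "open (c ` (U \<inter> F -` U))" by (rule chart_image_open[OF chart op])
    show "a \<in> c ` (U \<inter> F -` U)" using F one_in_U by (auto simp: pointed_def a_def)
  qed (use chart in \<open>auto simp: c_inv_def\<close>)
qed

lemma differential_compose:
  assumes "pointed F" "pointed F'"
  shows "differential (\<lambda>x. F (F' x)) = differential F \<circ> differential F'"
  using frechet_derivative_at[OF has_derivative_compose_pointed[OF assms(2) pointed_has_derivative[OF assms(1)]]]
  by (simp add: differential_def o_def)

lemma differential_id: "differential (\<lambda>x. x) = (\<lambda>v. v)"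
proof -
  have "((\<lambda>x. x) has_derivative (\<lambda>v. v)) (at a)" by simp
  then have "((\<lambda>x. c (c_inv x)) has_derivative (\<lambda>v. v)) (at a)"
    by (rule has_derivative_transform_within_open[OF _ open_charts[OF chart] a_in])
       (use chart in \<open>auto simp: c_inv_def\<close>)
  from frechet_derivative_at[OF this] show ?thesis by (simp add: differential_def)
qed

lemma pointed_smooth_map:
  assumes "smooth_map A A F" "F \<one> = \<one>"
  shows "pointed F"
  unfolding pointed_def
proof (intro conjI exI)
  show "continuous_on UNIV F" using assms(1) by (simp add: smooth_map_def)
  then show "open (F -` U)" using chart_homeomorphism(1)[OF chart] by (simp add: open_vimage)
  show "smooth_in A (F -` U) (\<lambda>x. c (F x))"
    by (rule smooth_in_compose_map[OF assms(1) smooth_in_chart_map[OF chart] chart_homeomorphism(1)[OF chart]])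
qed (use assms one_in_U in auto)

section \<open>The adjoint action and its continuity\<close>

definition Ad :: "'a \<Rightarrow> 'e \<Rightarrow> 'e" where
  "Ad g = differential (\<lambda>x. g \<otimes> x \<otimes> inv g)"

lemma pointed_conj: "pointed (\<lambda>x. g \<otimes> x \<otimes> inv g)"
  unfolding pointed_def
proof (intro conjI exI)
  have opU: "open U" using chart_homeomorphism(1)[OF chart] .
  have op: "open ((\<lambda>x. x \<otimes> inv g) -` U)"
    using continuous_rmult[of UNIV] opU by (simp add: open_vimage)
  show "continuous_on UNIV (\<lambda>x. g \<otimes> x \<otimes> inv g)"
    by (rule continuous_on_compose2[OF continuous_rmult continuous_lmult]) auto
  show "smooth_in A ((\<lambda>x. g \<otimes> x) -` ((\<lambda>x. x \<otimes> inv g) -` U)) (\<lambda>x. c (g \<otimes> x \<otimes> inv g))"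
    by (rule smooth_in_lmult[OF smooth_in_rmult[OF smooth_in_chart_map[OF chart] opU] op])
  show "open ((\<lambda>x. g \<otimes> x) -` ((\<lambda>x. x \<otimes> inv g) -` U))"
    using continuous_lmult[of UNIV] op by (simp add: open_vimage)
qed (use one_in_U in auto)

lemma linear_Ad: "linear (Ad g)"
  unfolding Ad_def by (rule linear_differential[OF pointed_conj])

lemma Ad_one: "Ad \<one> = (\<lambda>v. v)"
  using differential_id by (simp add: Ad_def)

lemma Ad_mult: "Ad (g \<otimes> h) = Ad g \<circ> Ad h"
  unfolding Ad_def differential_compose[OF pointed_conj pointed_conj, symmetric]
  by (simp add: m_assoc inv_mult_group)

text \<open>Powers of \<open>Ad g\<close> are again adjoint maps, so a bound uniform over the group
  bounds all powers.\<close>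

lemma Ad_pow: "Ad g ^^ k = Ad (g [^] k)"
proof (induction k)
  case 0
  then show ?case by (auto simp: Ad_one)
next
  case (Suc k)
  then show ?case unfolding nat_pow_Suc2[OF in_carrier] Ad_mult by simp
qed

text \<open>Locally, \<open>c (g x (inv g))\<close> is jointly smooth in the coordinates of
  \<open>g\<close> and \<open>x\<close>. \<open>Ad g w\<close> is its partial derivative in
  \<open>x\<close>, hence continuous in \<open>g\<close>.\<close>

lemma continuous_Ad: "continuous_on UNIV (\<lambda>g. Ad g w)"
proof -
  have cont_inv: "continuous_on UNIV (\<lambda>x. inv x)"
    using smooth_inv by (simp add: smooth_map_def)
  have "\<exists>N. open N \<and> g0 \<in> N \<and> continuous_on N (\<lambda>g. Ad g w)" for g0
  proof -
    obtain V d where A: "(V, d) \<in> A" "g0 \<in> V" using chart_at .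
    obtain V' d' where A': "(V', d') \<in> A" "inv g0 \<in> V'" using chart_at .
    have opV: "open U" "open V" "open V'" using chart_homeomorphism(1) chart A A' by blast+
    \<comment> \<open>Here \<open>g\<close> is read in the chart \<open>d\<close> and
      \<open>inv g\<close> in the chart \<open>d'\<close>.\<close>
    define N where "N = V \<inter> (\<lambda>x. inv x) -` V'"
    have opN: "open N"
      unfolding N_def using cont_inv opV by (intro open_Int open_vimage)
    let ?p = "\<lambda>(y, x). d (inv_into V d y \<otimes> inv_into U c x)"
    let ?q = "d' \<circ> (\<lambda>x. inv x) \<circ> inv_into V d"
    let ?r = "\<lambda>(y, x). c (inv_into V d y \<otimes> inv_into V' d' x)"
    let ?P = "mult_dom V V d U c" and ?Q = "d ` N" and ?R = "mult_dom U V d V' d'"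
    have opQ: "open ?Q"
      unfolding N_def by (intro chart_image_open[OF A(1)] open_vimage cont_inv opV)
    have opP: "open ?P" by (rule open_mult_dom[OF A(1) chart opV(2)])
    have opR: "open ?R" by (rule open_mult_dom[OF A(1) A'(1) opV(1)])
    \<comment> \<open>Here the product of \<open>g\<close> and \<open>x\<close> also stays in
      \<open>V\<close>. The chart of \<open>g\<close> can serve for it, since the product is
      \<open>g\<close> when \<open>x\<close> is the identity.\<close>
    define T where "T = ?P \<inter> ?Q \<times> UNIV"
    have opT: "open T" unfolding T_def by (intro open_Int opP open_Times opQ open_UNIV)
    have p: "smooth_on ?p T"
      by (rule smooth_on_subset[OF smooth_mult_chart[OF smooth_in_chart_map[OF A(1)] opV(2) A(1) chart] opP opT])
         (auto simp: T_def)
    have q0: "smooth_on ?q ?Q"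
      using smooth_inv A A' unfolding smooth_map_def N_def by blast
    have q: "smooth_on (\<lambda>z. ?q (fst z)) T"
      by (rule smooth_on_compose[OF opT opQ _ q0 smooth_on_linear[OF bounded_linear_fst opT]])
         (auto simp: T_def)
    define H where "H = (\<lambda>z. (?p z, ?q (fst z)))"
    have H: "smooth_on H T"
      unfolding H_def by (rule smooth_on_Pair[OF opT p q])
    \<comment> \<open>The last restriction: the whole conjugate has to lie in the chart at the
      identity.\<close>
    define S where "S = T \<inter> H -` ?R"
    have opS: "open S"
      unfolding S_def by (rule continuous_open_preimage[OF smooth_on_continuous[OF H] opT opR])
    have K: "smooth_on (\<lambda>z. ?r (H z)) S"
      by (rule smooth_on_compose[OF opS opR _ smooth_mult_chart[OF smooth_in_chart_map[OF chart] opV(1) A(1) A'(1)]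
            smooth_on_subset[OF H opT opS]]) (auto simp: S_def)
    have KS: "?r (H (d g, x)) = c (g \<otimes> c_inv x \<otimes> inv g)" if "g \<in> N" "(d g, x) \<in> S" for g x
      using that A A' by (auto simp: S_def T_def H_def N_def mult_dom_def c_inv_def)
    have mem: "(d g, a) \<in> S" if "g \<in> N" for g
      using that A A' a_in c_inv_a one_in_U
      by (auto simp: S_def T_def H_def N_def mult_dom_def c_inv_def)
    have Ad: "Ad g w = frechet_derivative (\<lambda>z. ?r (H z)) (at (d g, a)) (0, w)" if g: "g \<in> N" for g
    proof -
      have "open (Pair (d g) -` S)" by (intro open_vimage opS continuous_intros)
      have "((\<lambda>x. ?r (H (d g, x))) has_derivative
             (\<lambda>v. frechet_derivative (\<lambda>z. ?r (H z)) (at (d g, a)) (0, v))) (at a)"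
        by (rule has_derivative_slice_snd[OF smooth_on_has_derivative[OF K opS mem[OF g]]])
      then have "((\<lambda>x. c (g \<otimes> c_inv x \<otimes> inv g)) has_derivative
             (\<lambda>v. frechet_derivative (\<lambda>z. ?r (H z)) (at (d g, a)) (0, v))) (at a)"
        by (rule has_derivative_transform_within_open[OF _ \<open>open (Pair (d g) -` S)\<close>])
           (use mem[OF g] KS[OF g] in auto)
      from fun_cong[OF frechet_derivative_at[OF this], of w] show ?thesis
        by (simp add: Ad_def differential_def)
    qed
    have "continuous_on N (\<lambda>g. frechet_derivative (\<lambda>z. ?r (H z)) (at (d g, a)) (0, w))"
    proof (rule continuous_on_compose2[OF smooth_on_continuous[OF smooth_on_derivative[OF K opS]]])
      show "continuous_on N (\<lambda>g. (d g, a))"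
        by (intro continuous_intros continuous_on_subset[OF chart_continuous(1)[OF A(1)]]) (auto simp: N_def)
    qed (use mem in auto)
    then have "continuous_on N (\<lambda>g. Ad g w)"
      by (rule continuous_on_cong[THEN iffD1, rotated -1]) (simp_all add: Ad)
    moreover have "g0 \<in> N" using A A' by (simp add: N_def)
    ultimately show ?thesis using opN by blast
  qed
  then have "isCont (\<lambda>g. Ad g w) g0" for g0
    by (metis continuous_on_eq_continuous_at)
  then show ?thesis by (simp add: continuous_at_imp_continuous_on)
qed

section \<open>The trace of the adjoint action\<close>

definition ad_trace :: "'a \<Rightarrow> real" where "ad_trace g = lin_trace (Ad g)"

lemma continuous_ad_trace: "continuous_on UNIV ad_trace"
  unfolding ad_trace_def lin_trace_def by (intro continuous_intros continuous_Ad)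

lemma Ad_bounded:
  assumes "compact (UNIV :: 'a set)"
  obtains C where "C > 0" "\<And>g x. norm (Ad g x) \<le> C * norm x"
proof -
  have "\<exists>M. \<forall>g. norm (Ad g b) \<le> M" for b
    using compact_imp_bounded[OF compact_continuous_image[OF continuous_Ad assms]]
    by (auto simp: bounded_iff)
  then obtain M where M: "\<And>b g. norm (Ad g b) \<le> M b" by metis
  \<comment> \<open>The summand 1 makes the constant strictly positive.\<close>
  have "norm (Ad g x) \<le> ((\<Sum>b\<in>Basis. M b) + 1) * norm x" for g x
  proof -
    have "norm (Ad g x) = norm (\<Sum>b\<in>Basis. (x \<bullet> b) *\<^sub>R Ad g b)"
      by (subst euclidean_representation[of x, symmetric])
         (simp only: linear_sum[OF linear_Ad] linear_cmul[OF linear_Ad])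
    also have "\<dots> \<le> (\<Sum>b\<in>Basis. norm x * M b)"
      by (intro sum_norm_le) (auto intro!: mult_mono M Basis_le_norm)
    also have "\<dots> \<le> ((\<Sum>b\<in>Basis. M b) + 1) * norm x"
      by (simp add: sum_distrib_left algebra_simps)
    finally show ?thesis .
  qed
  moreover have "(\<Sum>b\<in>Basis. M b) + 1 > (0::real)"
  proof -
    have "M b \<ge> 0" for b using M[of \<one> b] norm_ge_zero order_trans by blast
    then show ?thesis by (simp add: add_nonneg_pos sum_nonneg)
  qed
  ultimately show thesis using that by blast
qed

lemma ad_trace_compact:
  assumes "compact (UNIV :: 'a set)"
  shows ad_trace_le: "ad_trace g \<le> DIM('e)"
    and ad_trace_eq: "ad_trace g = DIM('e) \<longleftrightarrow> Ad g = (\<lambda>v. v)"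
proof -
  obtain C where C: "C > 0" "\<And>g x. norm (Ad g x) \<le> C * norm x" using Ad_bounded[OF assms] by blast
  have up: "norm ((Ad g ^^ k) x) \<le> C * norm x" for k x
    unfolding Ad_pow by (rule C)
  have low: "norm x \<le> C * norm ((Ad g ^^ k) x)" for k x
  proof -
    \<comment> \<open>The inverse of a power of \<open>Ad g\<close> is again an adjoint map, so the
      same \<open>C\<close> bounds the powers from below.\<close>
    have "x = Ad (inv (g [^] k)) (Ad (g [^] k) x)"
      using fun_cong[OF Ad_mult[of "inv (g [^] k)" "g [^] k"], of x] by (simp add: Ad_one)
    then show ?thesis unfolding Ad_pow using C(2) by metis
  qed
  show "ad_trace g \<le> DIM('e)"
    unfolding ad_trace_def by (rule lin_trace_le[OF linear_Ad up low C(1)])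
  show "ad_trace g = DIM('e) \<longleftrightarrow> Ad g = (\<lambda>v. v)"
    using lin_trace_eq_imp_id[OF linear_Ad up low C(1)] lin_trace_id
    unfolding ad_trace_def by auto
qed

lemma ad_trace_automorphism:
  assumes "F \<in> lie_automorphisms G A"
  shows "ad_trace (F g) = ad_trace g"
proof -
  define F' where "F' = inv_into (carrier G) F"
  have hom: "F \<in> hom G G" and bij: "bij F" and sm: "smooth_map A A F" "smooth_map A A F'"
    using assms by (auto simp: lie_automorphisms_def iso_def carrier_UNIV F'_def)
  have Fone: "F \<one> = \<one>" using hom hom_one[of F G G] is_group by simp
  have FF': "F (F' x) = x" and F'F: "F' (F x) = x" for x
    using bij by (simp_all add: F'_def carrier_UNIV bij_is_surj surj_f_inv_f bij_is_inj inv_f_f)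
  have "F' \<one> = \<one>" using F'F[of \<one>] Fone by simp
  with sm Fone have F: "pointed F" and F': "pointed F'" by (auto intro: pointed_smooth_map)
  have mult: "F (x \<otimes> y) = F x \<otimes> F y" for x y using hom by (simp add: hom_def carrier_UNIV)
  have inv: "F (inv x) = inv (F x)" for x
    using mult[of "inv x" x] Fone inv_equality[of "F (inv x)" "F x"] by simp
  \<comment> \<open>The chain rule applied to the identity that \<open>F\<close> intertwines
    conjugation by \<open>g\<close> with conjugation by \<open>F g\<close>.\<close>
  have "differential F \<circ> Ad g = Ad (F g) \<circ> differential F"
    unfolding Ad_def differential_compose[OF F pointed_conj, symmetric]
      differential_compose[OF pointed_conj F, symmetric]
    by (simp add: mult inv)
  moreover have E: "differential F \<circ> differential F' = (\<lambda>v. v)" "differential F' \<circ> differential F = (\<lambda>v. v)"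
    unfolding differential_compose[OF F F', symmetric] differential_compose[OF F' F, symmetric]
    by (simp_all add: FF' F'F differential_id)
  ultimately have "Ad (F g) = (differential F \<circ> Ad g) \<circ> differential F'"
    by (simp add: fun_eq_iff)
  then have "ad_trace (F g) = lin_trace (differential F' \<circ> (differential F \<circ> Ad g))"
    using linear_differential F F' linear_Ad
    by (simp add: ad_trace_def lin_trace_commute linear_compose)
  also have "differential F' \<circ> (differential F \<circ> Ad g) = Ad g"
    using E(2) by (simp add: fun_eq_iff)
  finally show ?thesis by (simp add: ad_trace_def)
qed

end

section \<open>Isolation of the kernel of the adjoint representation\<close>

context lie_group_chart
begin

lemma left_vfield_linear:
  "left_vfield (s *\<^sub>R v + t *\<^sub>R w) p f = s * left_vfield v p f + t * left_vfield w p f"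
  using has_derivative_linear[OF smooth_fun_at_has_derivative, of p f]
  by (simp add: left_vfield_def linear_add linear_cmul)

lemma left_vfield_smooth_fun_at: "smooth_fun_at A p f \<Longrightarrow> smooth_fun_at A p (\<lambda>q. left_vfield v q f)"
  unfolding smooth_fun_at_iff using left_vfield_smooth by blast

text \<open>If \<open>Ad g = id\<close>, the differentials at \<open>\<one>\<close> of the left and right translations by \<open>g\<close>
  agree. Differentiating this along elements \<open>g\<close> tending to \<open>\<one>\<close> in the direction \<open>v\<close> shows
  that the two iterated derivatives coincide.\<close>

lemma left_vfield_commute_at_one:
  assumes y: "\<And>n. y n \<in> c ` U" "y \<longlonglongrightarrow> a" "\<And>n. y n \<noteq> a"
    and dir: "(\<lambda>n. inverse (norm (y n - a)) *\<^sub>R (y n - a)) \<longlonglongrightarrow> v"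
    and Ad: "\<And>n. Ad (c_inv (y n)) = (\<lambda>v. v)"
    and h: "smooth_fun_at A \<one> h"
  shows "left_vfield w \<one> (\<lambda>q. left_vfield v q h) = left_vfield v \<one> (\<lambda>q. left_vfield w q h)"
proof -
  obtain W where W: "smooth_in A W h" "open W" "\<one> \<in> W"
    using h unfolding smooth_fun_at_iff by blast
  let ?F = "\<lambda>(y, x). h (inv_into U c y \<otimes> inv_into U c x)"
  let ?S = "mult_dom W U c U c" and ?N = "c ` (U \<inter> W)"
  let ?D = "\<lambda>u z. frechet_derivative ?F (at z) u"
  let ?DD = "\<lambda>s t. frechet_derivative (?D s) (at (a, a)) t"
  note opS = open_mult_dom[OF chart chart W(2)]
  note F = smooth_mult_chart[OF W(1,2) chart chart]
  note opN = chart_image_open[OF chart W(2)]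
  have aN: "a \<in> ?N" using one_in_U W(3) by (auto simp: a_def)
  have left: "(y, a) \<in> ?S" and right: "(a, y) \<in> ?S" if "y \<in> ?N" for y
    using that chart a_in c_inv_a by (auto simp: mult_dom_def c_inv_def)
  have F': "(?F has_derivative frechet_derivative ?F (at z)) (at z)" if "z \<in> ?S" for z
    using smooth_on_has_derivative[OF F opS that] .
  have F'': "(?D s has_derivative ?DD s) (at (a, a))" for s
    by (rule smooth_on_has_derivative[OF smooth_on_derivative[OF F opS] opS left[OF aN]])
  have sym: "?DD s t = ?DD t s" for s t
    by (rule symmetric_second_derivative[OF F opS left[OF aN]])
  have derL: "((\<lambda>x. h (c_inv y \<otimes> c_inv x)) has_derivative (\<lambda>u. ?D (0, u) (y, a))) (at a)"
    if "y \<in> ?N" for y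
    using has_derivative_slice_snd[OF F'[OF left[OF that]]] by (simp add: c_inv_def)
  have derR: "((\<lambda>x. h (c_inv x \<otimes> c_inv y)) has_derivative (\<lambda>u. ?D (u, 0) (a, y))) (at a)"
    if "y \<in> ?N" for y
    using has_derivative_slice_fst[OF F'[OF right[OF that]]] by (simp add: c_inv_def)
  \<comment> \<open>At a point with coordinate \<open>y\<close>, the inner field is the
    \<open>x\<close>-derivative of \<open>h (y x)\<close>; the outer one differentiates this in
    \<open>y\<close>. Iterated derivatives thus are mixed second partials at
    \<open>(a, a)\<close>.\<close>
  have iterated: "left_vfield u \<one> (\<lambda>q. left_vfield t q h) = ?DD (0, t) (u, 0)" for t u
  proof -
    have "((\<lambda>y. ?D (0, t) (y, a)) has_derivative (\<lambda>u. ?DD (0, t) (u, 0))) (at a)"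
      by (rule has_derivative_slice_fst[OF F''])
    then have "((\<lambda>x. left_vfield t (\<one> \<otimes> c_inv x) h) has_derivative (\<lambda>u. ?DD (0, t) (u, 0))) (at a)"
    proof (rule has_derivative_transform_within_open[OF _ opN aN])
      fix x assume x: "x \<in> ?N"
      then have "smooth_fun_at A (c_inv x) h"
        using chart W by (auto simp: smooth_fun_at_iff c_inv_def)
      then show "?D (0, t) (x, a) = left_vfield t (\<one> \<otimes> c_inv x) h"
        using fun_cong[OF frechet_derivative_at[OF derL[OF x]], of t] by (simp add: left_vfield_def)
    qed
    from fun_cong[OF frechet_derivative_at[OF this], of u] show ?thesis
      by (simp add: left_vfield_def[of u] left_vfield_smooth_fun_at[OF h])
  qed
  \<comment> \<open>The difference of the derivatives, in direction \<open>w\<close> at the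
    identity, of \<open>h\<close> composed with left and with right translation by the element with
    coordinate \<open>y\<close>.\<close>
  define P where "P = (\<lambda>y. ?D (0, w) (y, a) - ?D (w, 0) (a, y))"
  have P': "(P has_derivative (\<lambda>u. ?DD (0, w) (u, 0) - ?DD (w, 0) (0, u))) (at a)"
    unfolding P_def
    by (intro has_derivative_diff has_derivative_slice_fst[OF F''] has_derivative_slice_snd[OF F''])
  have P0: "P y = 0" if y: "y \<in> ?N" and Ad: "Ad (c_inv y) = (\<lambda>v. v)" for y
  proof -
    \<comment> \<open>Left translation is conjugation followed by right translation; when the
      adjoint map is the identity, both translations have the same differential.\<close>
    have "((\<lambda>x. h (c_inv y \<otimes> c_inv x \<otimes> inv (c_inv y) \<otimes> c_inv y)) has_derivative
            (\<lambda>u. ?D (Ad (c_inv y) u, 0) (a, y))) (at a)"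
      unfolding Ad_def by (rule has_derivative_compose_pointed[OF pointed_conj derR[OF y]])
    then have "((\<lambda>x. h (c_inv y \<otimes> c_inv x)) has_derivative (\<lambda>u. ?D (u, 0) (a, y))) (at a)"
      by (simp add: m_assoc Ad)
    from has_derivative_unique[OF this derL[OF y]] show ?thesis
      by (simp add: P_def fun_eq_iff)
  qed
  \<comment> \<open>Only a tail of the sequence need lie where \<open>h\<close> is smooth, hence the
    shift by \<open>m\<close>.\<close>
  have "eventually (\<lambda>n. y n \<in> ?N) sequentially"
    using topological_tendstoD[OF y(2) opN aN] .
  then obtain m where m: "\<And>n. n \<ge> m \<Longrightarrow> y n \<in> ?N" by (auto simp: eventually_sequentially)
  have "?DD (0, w) (v, 0) - ?DD (w, 0) (0, v) = 0"
  proof (rule has_derivative_zero_along_sequence[OF P'])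
    show "P a = 0" using P0[OF aN] by (simp add: Ad_one)
    show "P (y (n + m)) = 0" for n using P0 m Ad by simp
    show "(\<lambda>n. y (n + m)) \<longlonglongrightarrow> a" using LIMSEQ_ignore_initial_segment[OF y(2)] .
    show "y (n + m) \<noteq> a" for n using y(3) .
    show "(\<lambda>n. inverse (norm (y (n + m) - a)) *\<^sub>R (y (n + m) - a)) \<longlonglongrightarrow> v"
      using LIMSEQ_ignore_initial_segment[OF dir] .
  qed
  then show ?thesis unfolding iterated using sym[of "(w, 0)" "(0, v)"] by simp
qed

text \<open>Left invariance carries the commutation at the identity to every point, and the scalar
  \<open>s\<close> covers the whole line spanned by \<open>v\<close>.\<close>

lemma bracket_left_vfield_zero:
  assumes comm: "\<And>w h. smooth_fun_at A \<one> h \<Longrightarrow> left_vfield w \<one> (\<lambda>q. left_vfield v q h) = left_vfield v \<one> (\<lambda>q. left_vfield w q h)"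
    and Y: "Y \<in> lie_algebra G A"
  shows "vfield_bracket A Y (left_vfield (s *\<^sub>R v)) = zero_vfield"
proof -
  obtain w where w: "Y = left_vfield w" using lie_algebra_left_vfield[OF Y] .
  have scale: "left_vfield (s *\<^sub>R v) p f = s * left_vfield v p f" for p f
    using left_vfield_linear[of s v 0 0] by simp
  have "left_vfield w p (\<lambda>q. left_vfield (s *\<^sub>R v) q f) - left_vfield (s *\<^sub>R v) p (\<lambda>q. left_vfield w q f) = 0"
    if f: "smooth_fun_at A p f" for p f
  proof -
    have h: "smooth_fun_at A \<one> (\<lambda>x. f (p \<otimes> x))"
      using f smooth_fun_at_translate[of p \<one> f] by simp
    have move: "left_vfield u p (\<lambda>q. left_vfield t q f) = left_vfield u \<one> (\<lambda>q. left_vfield t q (\<lambda>x. f (p \<otimes> x)))" for u t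
      using left_vfield_translate[of u p \<one> "\<lambda>q. left_vfield t q f"] by (simp add: left_vfield_translate)
    \<comment> \<open>Homogeneity of the derivation, written with a zero summand to match the
      linearity clause of \<open>tangent_space\<close>.\<close>
    have "left_vfield w p (\<lambda>q. s * k q + 0 * k q) = s * left_vfield w p k + 0 * left_vfield w p k"
      if "smooth_fun_at A p k" for k
      using left_vfield_tangent[of w p] that unfolding tangent_space_def by blast
    from this[OF left_vfield_smooth_fun_at[OF f, of v]]
    show ?thesis using comm[OF h, of w] by (simp add: scale move)
  qed
  then show ?thesis by (simp add: vfield_bracket_def zero_vfield_def w fun_eq_iff)
qed

text \<open>The hypothesis makes the line spanned by \<open>left_vfield v\<close> an ideal with zero
  brackets, so one derived algebra reaches zero. Semisimplicity collapses the line, and only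
  \<open>v = 0\<close> gives the zero field.\<close>

lemma central_direction_zero:
  assumes "semisimple_lie_group G A"
    and comm: "\<And>w h. smooth_fun_at A \<one> h \<Longrightarrow> left_vfield w \<one> (\<lambda>q. left_vfield v q h) = left_vfield v \<one> (\<lambda>q. left_vfield w q h)"
  shows "v = 0"
proof -
  define I where "I = range (\<lambda>s. left_vfield (s *\<^sub>R v))"
  have zero: "left_vfield 0 = zero_vfield"
    using left_vfield_linear[of 0 0 0 0] by (simp add: zero_vfield_def fun_eq_iff)
  have bracket: "vfield_bracket A Y Z = zero_vfield" if "Y \<in> lie_algebra G A" "Z \<in> I" for Y Z
    using bracket_left_vfield_zero[OF comm that(1)] that(2) by (auto simp: I_def)
  have IL: "I \<subseteq> lie_algebra G A" using left_vfield_in_lie_algebra by (auto simp: I_def)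
  have zero_I: "zero_vfield \<in> I"
    using zero by (auto simp: I_def intro!: image_eqI[of _ _ 0])
  have "vfield_subspace I"
    unfolding vfield_subspace_def
  proof (intro conjI ballI allI zero_I)
    fix Y Z s t assume "Y \<in> I" "Z \<in> I"
    then obtain y z where "Y = left_vfield (y *\<^sub>R v)" "Z = left_vfield (z *\<^sub>R v)" by (auto simp: I_def)
    then have "(\<lambda>p f. s * Y p f + t * Z p f) = left_vfield ((s * y + t * z) *\<^sub>R v)"
      by (simp add: fun_eq_iff scaleR_add_left left_vfield_linear flip: scaleR_scaleR)
    then show "(\<lambda>p f. s * Y p f + t * Z p f) \<in> I" by (simp add: I_def)
  qed
  then have "lie_ideal A (lie_algebra G A) I"
    using IL bracket zero_I by (auto simp: lie_ideal_def)
  moreover have "derived_algebra A I = {zero_vfield}"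
  proof
    have "vfield_subspace {zero_vfield}" by (simp add: vfield_subspace_def zero_vfield_def)
    then show "derived_algebra A I \<subseteq> {zero_vfield}"
      using bracket IL unfolding derived_algebra_def by blast
    show "{zero_vfield} \<subseteq> derived_algebra A I"
      by (auto simp: derived_algebra_def vfield_subspace_def)
  qed
  then have "solvable_algebra A I"
    unfolding solvable_algebra_def by (intro exI[of _ 1]) simp
  ultimately have "I = {zero_vfield}"
    using assms(1) by (auto simp: semisimple_lie_group_def semisimple_algebra_def)
  moreover have "left_vfield v \<in> I" by (auto simp: I_def intro!: image_eqI[of _ _ 1])
  ultimately show "v = 0" using left_vfield_nonzero by blast
qed

text \<open>Kernel elements tending to the identity have normalised chart differences on the unit
  sphere. A limit direction of theirs has norm 1, yet it is central and hence zero.\<close>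

lemma kernel_Ad_isolated:
  assumes "semisimple_lie_group G A"
  shows "\<exists>N. open N \<and> \<one> \<in> N \<and> (\<forall>g\<in>N. Ad g = (\<lambda>v. v) \<longrightarrow> g = \<one>)"
proof (rule ccontr)
  assume not_isolated: "\<not> ?thesis"
  have "\<exists>y. y \<in> c ` U \<and> y \<noteq> a \<and> dist y a < inverse (real (Suc n)) \<and> Ad (c_inv y) = (\<lambda>v. v)" for n
  proof -
    define N where "N = U \<inter> c -` ball a (inverse (real (Suc n)))"
    have "open N" "\<one> \<in> N"
      using continuous_open_preimage[OF chart_continuous(1)[OF chart] chart_homeomorphism(1)[OF chart] open_ball]
        one_in_U by (auto simp: N_def a_def)
    then obtain g where g: "g \<in> N" "Ad g = (\<lambda>v. v)" "g \<noteq> \<one>"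
      using not_isolated by blast
    have "c g \<noteq> a"
      using g one_in_U chart_inj[OF chart] by (auto simp: a_def N_def dest: inj_onD)
    then show ?thesis
      using g chart by (intro exI[of _ "c g"]) (auto simp: N_def c_inv_def dist_commute)
  qed
  then obtain y where y: "\<And>n. y n \<in> c ` U" "\<And>n. y n \<noteq> a"
    "\<And>n. dist (y n) a < inverse (real (Suc n))" "\<And>n. Ad (c_inv (y n)) = (\<lambda>v. v)" by metis
  have "(\<lambda>n. dist (y n) a) \<longlonglongrightarrow> 0"
    by (rule tendsto_sandwich[OF _ _ tendsto_const LIMSEQ_inverse_real_of_nat])
       (use less_imp_le[OF y(3)] in \<open>auto intro!: always_eventually\<close>)
  then have lim: "y \<longlonglongrightarrow> a" using tendsto_dist_iff by blast
  define u where "u = (\<lambda>n. inverse (norm (y n - a)) *\<^sub>R (y n - a))"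
  have norm_u: "norm (u n) = 1" for n using y(2)[of n] by (simp add: u_def)
  then have "bounded (range u)" by (auto simp: bounded_iff)
  then obtain v r where r: "strict_mono (r :: nat \<Rightarrow> nat)" and v: "(u \<circ> r) \<longlonglongrightarrow> v"
    using bounded_imp_convergent_subsequence by blast
  have "norm v = 1"
    using tendsto_norm[OF v] norm_u LIMSEQ_unique[OF tendsto_const] by fastforce
  moreover have "v = 0"
  proof (rule central_direction_zero[OF assms])
    fix w h assume h: "smooth_fun_at A \<one> h"
    show "left_vfield w \<one> (\<lambda>q. left_vfield v q h) = left_vfield v \<one> (\<lambda>q. left_vfield w q h)"
    proof (rule left_vfield_commute_at_one[OF _ _ _ _ _ h, of "y \<circ> r"])
      show "(y \<circ> r) \<longlonglongrightarrow> a" by (rule LIMSEQ_subseq_LIMSEQ[OF lim r])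
      show "(\<lambda>n. inverse (norm ((y \<circ> r) n - a)) *\<^sub>R ((y \<circ> r) n - a)) \<longlonglongrightarrow> v"
        using v by (simp add: u_def o_def)
    qed (use y in auto)
  qed
  ultimately show False by simp
qed

section \<open>Stability at the identity and at arbitrary fixed points\<close>

lemma stable_at_one:
  fixes \<phi> :: "real \<Rightarrow> 'a \<Rightarrow> 'a"
  assumes compact: "compact (UNIV :: 'a set)" and "semisimple_lie_group G A"
    and aut: "\<And>t. \<phi> t \<in> lie_automorphisms G A"
    and \<phi>0: "\<And>x. \<phi> 0 x = x" and cont: "\<And>x. continuous_on UNIV (\<lambda>t. \<phi> t x)"
    and O: "open O'" "\<one> \<in> O'"
  obtains V where "open V" "\<one> \<in> V" "\<And>t. t \<ge> 0 \<Longrightarrow> \<phi> t ` V \<subseteq> O'"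
proof -
  obtain N where N: "open N" "\<one> \<in> N" and iso: "\<And>g. g \<in> N \<Longrightarrow> Ad g = (\<lambda>v. v) \<Longrightarrow> g = \<one>"
    using kernel_Ad_isolated[OF assms(2)] by blast
  define M where "M = c ` (U \<inter> (N \<inter> O'))"
  have "open M" "a \<in> M"
    unfolding M_def using chart_image_open[OF chart open_Int[OF N(1) O(1)]] N O one_in_U
    by (auto simp: a_def)
  \<comment> \<open>A closed ball inside \<open>M\<close> has a compact image in the group, closed
    because the space is Hausdorff. This traps the closure of \<open>W\<close>, not only
    \<open>W\<close>, in \<open>N \<inter> O'\<close>.\<close>
  then obtain r where r: "r > 0" "cball a r \<subseteq> M" using open_contains_cball by blast
  have MU: "M \<subseteq> c ` U" by (auto simp: M_def)
  define W where "W = U \<inter> c -` ball a r"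
  have W: "open W" "\<one> \<in> W"
    using continuous_open_preimage[OF chart_continuous(1)[OF chart] chart_homeomorphism(1)[OF chart] open_ball]
      one_in_U r(1) by (auto simp: W_def a_def)
  have "compact (c_inv ` cball a r)"
    unfolding c_inv_def
    by (intro compact_continuous_image compact_cball continuous_on_subset[OF chart_continuous(2)[OF chart]])
       (use r MU in blast)
  then have "closed (c_inv ` cball a r)" by (rule compact_imp_closed)
  moreover have "W \<subseteq> c_inv ` cball a r"
  proof
    fix x assume "x \<in> W"
    then have "x = c_inv (c x)" "c x \<in> cball a r" using chart by (auto simp: W_def c_inv_def)
    then show "x \<in> c_inv ` cball a r" by blast
  qed
  ultimately have "closure W \<subseteq> c_inv ` cball a r" by (rule closure_minimal[rotated])
  also have "\<dots> \<subseteq> N \<inter> O'" using r(2) chart by (force simp: M_def c_inv_def)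
  finally have clW: "closure W \<subseteq> N \<inter> O'" .
  have fr_sub: "frontier W \<subseteq> N - {\<one>}"
    using clW W by (auto simp: frontier_def interior_open)
  have "compact (frontier W)"
    using compact_Int_closed[OF compact frontier_closed[of W]] by simp
  \<comment> \<open>A frontier point lies in \<open>N\<close> and differs from the identity, so its
    adjoint map is not the identity and the trace bound is strict.\<close>
  have lt: "ad_trace g < DIM('e)" if "g \<in> frontier W" for g
    using ad_trace_le[OF compact, of g] ad_trace_eq[OF compact, of g] iso[of g] fr_sub that by fastforce
  \<comment> \<open>A continuous function attains its maximum on the compact frontier. If the
    frontier is empty, any number below the dimension will do.\<close>
  obtain m :: real where m: "m < DIM('e)" "\<And>g. g \<in> frontier W \<Longrightarrow> ad_trace g \<le> m"
  proof (cases "frontier W = {}")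
    case True
    then show ?thesis using that[of "real DIM('e) - 1"] by simp
  next
    case False
    from continuous_attains_sup[OF \<open>compact (frontier W)\<close> False
        continuous_on_subset[OF continuous_ad_trace subset_UNIV]]
    obtain g where "g \<in> frontier W" "\<And>g'. g' \<in> frontier W \<Longrightarrow> ad_trace g' \<le> ad_trace g" by blast
    then show ?thesis using that[of "ad_trace g"] lt by blast
  qed
  define V where "V = W \<inter> ad_trace -` {m<..}"
  show thesis
  proof
    show "open V"
      unfolding V_def by (intro open_Int W open_vimage continuous_ad_trace open_greaterThan)
    show "\<one> \<in> V"
      using W m ad_trace_eq[OF compact, of \<one>] by (simp add: V_def Ad_one)
    show "\<phi> t ` V \<subseteq> O'" if "t \<ge> 0" for t
    proof
      fix z assume "z \<in> \<phi> t ` V"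
      then obtain x where x: "x \<in> V" "z = \<phi> t x" by blast
      let ?path = "(\<lambda>s. \<phi> s x) ` {0..t}"
      have "connected ?path"
        by (rule connected_continuous_image[OF continuous_on_subset[OF cont subset_UNIV] connected_Icc])
      \<comment> \<open>The trace is constant along the orbit and exceeds \<open>m\<close> at its
        start, while it is at most \<open>m\<close> on the frontier.\<close>
      moreover have "?path \<inter> frontier W = {}"
        using m(2) x(1) ad_trace_automorphism[OF aut] by (force simp: V_def)
      moreover have "x \<in> ?path \<inter> W"
        using x that \<phi>0 by (auto simp: V_def intro!: image_eqI[of _ _ 0])
      ultimately have "?path \<subseteq> W"
        using connected_Int_frontier[of ?path W] by blast
      then have "z \<in> W" using x that by auto
      then show "z \<in> O'" using clW closure_subset by blast
    qed
  qed
qed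

end

text \<open>The indicator function of an open set \<open>W\<close> is smooth at the points of \<open>W\<close>, so it may be
  differentiated along the flow.\<close>

lemma is_flow_continuous:
  assumes "smooth_atlas A" "is_flow A X \<phi>"
    and const: "\<And>W. open W \<Longrightarrow> smooth_fun_on A W (\<lambda>x. 1)"
  shows "continuous_on UNIV (\<lambda>t. \<phi> t x)"
proof -
  have "((\<lambda>s. \<phi> s x) \<longlongrightarrow> \<phi> t x) (at t)" for t
  proof (rule topological_tendstoI)
    fix W assume W: "open W" "\<phi> t x \<in> W"
    let ?f = "\<lambda>x. if x \<in> W then 1 else (0::real)"
    have "smooth_fun_on A W ?f \<longleftrightarrow> smooth_fun_on A W (\<lambda>x. 1)"
    proof -
      have "smooth_on (?f \<circ> inv_into V d) (d ` (V \<inter> W)) \<longleftrightarrow>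
            smooth_on ((\<lambda>x. 1 :: real) \<circ> inv_into V d) (d ` (V \<inter> W))" if "(V, d) \<in> A" for V d
      proof -
        have "homeomorphism V (d ` V) d (inv_into V d)"
          using assms(1) that by (auto simp: smooth_atlas_def)
        show ?thesis
          by (rule smooth_on_cong)
             (use \<open>homeomorphism V (d ` V) d (inv_into V d)\<close> in \<open>auto simp: homeomorphism_def\<close>)
      qed
      then show ?thesis unfolding smooth_fun_on_def by blast
    qed
    then have "smooth_fun_at A (\<phi> t x) ?f"
      unfolding smooth_fun_at_def using const W by blast
    then have "((\<lambda>s. ?f (\<phi> s x)) has_real_derivative X (\<phi> t x) ?f) (at t)"
      by (rule assms(2)[unfolded is_flow_def, THEN conjunct2, rule_format])
    then have "isCont (\<lambda>s. ?f (\<phi> s x)) t" by (rule DERIV_isCont)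
    then have "((\<lambda>s. ?f (\<phi> s x)) \<longlongrightarrow> 1) (at t)" using W by (simp add: isCont_def)
    \<comment> \<open>The indicator takes only the values 0 and 1, so positivity already means
      membership in \<open>W\<close>.\<close>
    then have "eventually (\<lambda>s. ?f (\<phi> s x) > 0) (at t)"
      by (rule order_tendstoD) simp
    then show "eventually (\<lambda>s. \<phi> s x \<in> W) (at t)"
      by (rule eventually_mono) (simp split: if_splits)
  qed
  then show ?thesis by (simp add: continuous_on_def)
qed

theorem theorem3p8:
  fixes G :: "'a::{t2_space, second_countable_topology} monoid"
    and A :: "('a, 'e::euclidean_space) chart set"
    and X :: "'a vfield"
    and \<phi> :: "real \<Rightarrow> 'a \<Rightarrow> 'a"
  assumes "lie_group G A"
    and "connected (carrier G)"
    and "compact (carrier G)"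
    and "semisimple_lie_group G A"
    and "linear_vector_field G A X \<phi>"
  shows "\<forall>g\<in>carrier G. fixed_point \<phi> g \<longrightarrow> stable_point \<phi> g"
proof (intro ballI impI)
  fix g assume "fixed_point \<phi> g"
  then have fixg: "\<phi> t g = g" for t by (simp add: fixed_point_def)
  interpret lie_group G A by fact
  have cover: "(\<Union>(U, c)\<in>A. U) = UNIV"
    and hom: "\<And>V d. (V, d) \<in> A \<Longrightarrow> open V \<and> homeomorphism V (d ` V) d (inv_into V d)"
    and dim: "(\<forall>(U, c)\<in>A. open (c ` U)) \<or> (\<forall>(U, c)\<in>A. c ` U \<subseteq> {0})"
    using atlas by (auto simp: smooth_atlas_def)
  have chart_ex: "\<exists>V d. (V, d) \<in> A \<and> x \<in> V" for x
  proof -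
    have "x \<in> (\<Union>(U, c)\<in>A. U)" by (simp add: cover)
    then show ?thesis by auto
  qed
  show "stable_point \<phi> g"
  proof (cases "\<forall>(U, c)\<in>A. c ` U \<subseteq> {0}")
    case True
    obtain V d where V: "(V, d) \<in> A" "g \<in> V" using chart_ex by blast
    \<comment> \<open>Dimension zero: the injective coordinate map has only the value 0, so its open
      domain is a single point.\<close>
    have "V \<subseteq> {g}"
    proof
      fix x assume "x \<in> V"
      then have "d x \<in> {0}" "d g \<in> {0}" using True V by blast+
      then have "d x = d g" by simp
      moreover have "inv_into V d (d x) = x" "inv_into V d (d g) = g"
        using homeomorphism_apply1[OF conjunct2[OF hom[OF V(1)]]] \<open>x \<in> V\<close> V(2) by blast+
      ultimately have "x = g" by metis
      then show "x \<in> {g}" by simp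
    qed
    then have "V = {g}" using V(2) by blast
    then have "open {g}" using hom[OF V(1)] by simp
    then show ?thesis
      unfolding stable_point_def by (intro allI impI exI[of _ "{g}"]) (simp add: fixg)
  next
    case False
    then have open_charts: "\<And>V d. (V, d) \<in> A \<Longrightarrow> open (d ` V)" using dim by blast
    obtain U c where U: "(U, c) \<in> A" "\<one>\<^bsub>G\<^esub> \<in> U" using chart_ex by blast
    interpret lie_group_chart G A U c
      by unfold_locales (use open_charts U in auto)
    have flow: "is_flow A X \<phi>" and aut: "\<And>t. \<phi> t \<in> lie_automorphisms G A"
      using assms(5) by (auto simp: linear_vector_field_def)
    have cont: "continuous_on UNIV (\<lambda>t. \<phi> t x)" for x
      by (rule is_flow_continuous[OF atlas flow]) (simp add: smooth_fun_on_iff smooth_in_const)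
    show ?thesis
      unfolding stable_point_def
    proof (intro allI impI)
      fix O' assume O: "open O' \<and> g \<in> O'"
      have op: "open ((\<lambda>x. h \<otimes>\<^bsub>G\<^esub> x) -` S)" if "open S" for h S
        using continuous_lmult[of UNIV] that by (simp add: open_vimage)
      obtain V where V: "open V" "\<one>\<^bsub>G\<^esub> \<in> V"
        "\<And>t. t \<ge> 0 \<Longrightarrow> \<phi> t ` V \<subseteq> (\<lambda>x. g \<otimes>\<^bsub>G\<^esub> x) -` O'"
      proof (rule stable_at_one[of \<phi> "(\<lambda>x. g \<otimes>\<^bsub>G\<^esub> x) -` O'"])
        show "compact (UNIV :: 'a set)" using assms(3) by (simp add: carrier_UNIV)
        show "\<phi> 0 x = x" for x using flow by (simp add: is_flow_def)
      qed (use assms(4) aut cont op O in auto)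
      \<comment> \<open>A homomorphism fixing \<open>g\<close> commutes with left translation by
        \<open>g\<close>, so the orbit of a point is the translate of an orbit starting near the
        identity.\<close>
      have "\<phi> t ` ((\<lambda>x. inv\<^bsub>G\<^esub> g \<otimes>\<^bsub>G\<^esub> x) -` V) \<subseteq> O'" if "t \<ge> 0" for t
      proof clarify
        fix x assume "inv\<^bsub>G\<^esub> g \<otimes>\<^bsub>G\<^esub> x \<in> V"
        then have "g \<otimes>\<^bsub>G\<^esub> \<phi> t (inv\<^bsub>G\<^esub> g \<otimes>\<^bsub>G\<^esub> x) \<in> O'" using V(3)[OF that] by auto
        moreover have "\<phi> t (g \<otimes>\<^bsub>G\<^esub> (inv\<^bsub>G\<^esub> g \<otimes>\<^bsub>G\<^esub> x)) = \<phi> t g \<otimes>\<^bsub>G\<^esub> \<phi> t (inv\<^bsub>G\<^esub> g \<otimes>\<^bsub>G\<^esub> x)"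
          using aut[of t] by (auto simp: lie_automorphisms_def iso_def hom_def carrier_UNIV)
        ultimately show "\<phi> t x \<in> O'" by (simp add: fixg flip: m_assoc)
      qed
      then show "\<exists>V. open V \<and> g \<in> V \<and> (\<forall>t\<ge>0. \<phi> t ` V \<subseteq> O')"
        using op[OF V(1)] V(2) by (intro exI[of _ "(\<lambda>x. inv\<^bsub>G\<^esub> g \<otimes>\<^bsub>G\<^esub> x) -` V"]) auto
    qed
  qed
qed

end
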